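(* Let $C\ge0$ be a constant and define $$P_{\mathrm{distr}}:\quad \min\{\mathbf c^T\mathbf x \mid \mathbf A\mathbf x=\mathbf b,\ \mathbf 0\le \mathbf x\le C\boldsymbol\xi\}.$$ Let $J=\{j_1,\dots,j_K\}$ be random indices in $[n]$, each with marginal distribution $\boldsymbol\xi$ but not necessarily independent, and assume they have dependency graph $G$ with forest complexity $\Lambda(G)$. Let $\gamma$ be an upper bound on $\|\mathbf p\|_\infty$ for every basic solution $\mathbf p$ of the dual $D$, and let $\chi$ be an upper bound on $\|\bar{\mathbf c}\|_2$ for the reduced cost vector $\bar{\mathbf c}$ of every basic solution of $P$. For any $\delta\in(0,1)$, with probability at least $1-\delta$ over the sample $J$, the following implication holds: if $P_J$ is feasible and $\mathrm{rank}(\mathbf A_J)=m$, then $$\Delta v(P_J)\le\Delta v(P_{\mathrm{distr}})+C\cdot(1+m\gamma\|\mathbf A\|_{\max})\cdot\left(\sqrt{\frac{K+2|E(G)|}{K^2}}+\sqrt{\frac{2\Lambda(G)\log(2/\delta)}{K^2}}\right).$$ Likewise, for any $\delta\in(0,1)$, with probability at least $1-\delta$ over the sample $J$, the following implication holds: if $P_J$ is feasible and $\mathrm{rank}(\mathbf A_J)=m$, then $$\Delta v(P_J)\le\Delta v(P_{\mathrm{distr}})+C\cdot\chi\cdot\left(\sqrt{\frac{K+2|E(G)|}{K^2}}+\sqrt{\frac{2\Lambda(G)\log(1/\delta)}{K^2}}\right).$$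
   Context: The complete problem is $P:\ \min\{\mathbf c^T\mathbf x\mid \mathbf A\mathbf x=\mathbf b,\ \mathbf x\ge \mathbf 0\}$ with $\mathbf A\in\mathbb R^{m\times n}$, $\mathbf b\in\mathbb R^m$, $\mathbf c\in\mathbb R^n$. Standing assumptions: $P$ is feasible and bounded, $\mathrm{rank}(\mathbf A)=m$, $\|\mathbf c\|_2=1$. Its dual is $D:\ \max\{\mathbf p^T\mathbf b\mid \mathbf p^T\mathbf A\le \mathbf c^T\}$. $\|\mathbf A\|_{\max}=\max_{i,j}|A_{i,j}|$. A basis is a set $B\subseteq[n]=\{1,\dots,n\}$ with $|B|=m$ and $\mathbf A_B$ nonsingular. The corresponding basic solution (not necessarily feasible) of $P$ has $\mathbf x_B=\mathbf A_B^{-1}\mathbf b$ and other components zero; that of $D$ is $\mathbf p^T=\mathbf c_B^T\mathbf A_B^{-1}$; the reduced cost vector is $\bar{\mathbf c}=\mathbf c^T-\mathbf c_B^T\mathbf A_B^{-1}\mathbf A$. $\boldsymbol\xi$ is a probability distribution on $[n]$, and $\Pr[j_k=t]=\xi_t$ for all $k\in[K]$, $t\in[n]$. $\mathbf A_J$ is the matrix whose columns are columns $j_1,\dots,j_K$ of $\mathbf A$, $\mathbf c_J=(c_{j_1},\dots,c_{j_K})$, and $P_J:\ \min\{\mathbf c_J^T\tilde{\mathbf x}\mid \mathbf A_J\tilde{\mathbf x}=\mathbf b,\ \tilde{\mathbf x}\ge\mathbf 0\}$. $v(\cdot)$ denotes the optimal value, with $v=+\infty$ for an infeasible minimization problem,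 and $\Delta v(P'')=v(P'')-v(P)$. Graphs are undirected, with vertex set $V(\cdot)$ and edge set $E(\cdot)$. A graph $G$ is a dependency graph of random variables $X_1,\dots,X_K$ if $V(G)=[K]$ and for all disjoint $I,I'\subseteq[K]$ such that no vertex of $I$ is adjacent to a vertex of $I'$, the families $\{X_i\}_{i\in I}$ and $\{X_i\}_{i\in I'}$ are independent. A forest approximation of $G$ is a pair $(\phi,F)$ with $F$ a forest (a graph without cycles) and $\phi:V(G)\to V(F)$ such that for every edge $\langle u,v\rangle\in E(G)$, either $\phi(u)=\phi(v)$ or $\langle\phi(u),\phi(v)\rangle\in E(F)$. Put $$\lambda_{(\phi,F)}=\sum_{\langle u,v\rangle\in E(F)}\big(|\phi^{-1}(u)|+|\phi^{-1}(v)|\big)^2+\sum_{i=1}^k\min_{u\in V(T_i)}|\phi^{-1}(u)|^2,$$ where $T_1,\dots,T_k$ are the trees (connected components) of $F$. The forest complexity is $\Lambda(G)=\min_{(\phi,F)}\lambda_{(\phi,F)}$, the minimum over all forest approximations of $G$. *)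

theory Defs
  imports "HOL-Probability.Probability"
begin

section \<open>Linear programs\<close>

definition std_feasible :: "real^'n^'m \<Rightarrow> real^'m \<Rightarrow> (real^'n) set" where
  "std_feasible A b = {x. A *v x = b \<and> (\<forall>j. 0 \<le> x $ j)}"

definition box_feasible :: "real^'n^'m \<Rightarrow> real^'m \<Rightarrow> real^'n \<Rightarrow> (real^'n) set" where
  "box_feasible A b u = {x. A *v x = b \<and> (\<forall>j. 0 \<le> x $ j \<and> x $ j \<le> u $ j)}"

text \<open>Optimal value of a minimization problem; it is \<open>\<infinity>\<close> on the empty feasible set.\<close>

definition opt_value :: "real^'n \<Rightarrow> (real^'n) set \<Rightarrow> ereal" where
  "opt_value c S = (INF x\<in>S. ereal (c \<bullet> x))"

definition lp_bounded :: "real^'n \<Rightarrow> (real^'n) set \<Rightarrow> bool" where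
  "lp_bounded c S \<longleftrightarrow> (\<exists>L. \<forall>x\<in>S. L \<le> c \<bullet> x)"

text \<open>The gap of a value \<open>v\<close> with respect to the complete problem given by \<open>A\<close>, \<open>b\<close>, \<open>c\<close>.\<close>

definition value_gap :: "real^'n^'m \<Rightarrow> real^'m \<Rightarrow> real^'n \<Rightarrow> ereal \<Rightarrow> ereal" where
  "value_gap A b c v = v - opt_value c (std_feasible A b)"

definition max_norm :: "real^'n^'m \<Rightarrow> real" where
  "max_norm A = Max {\<bar>A $ i $ j\<bar> | i j. True}"

text \<open>Selection of columns and components; the index family may have repetitions.\<close>

definition select_columns :: "real^'n^'m \<Rightarrow> ('k \<Rightarrow> 'n) \<Rightarrow> real^'k^'m" where
  "select_columns A \<beta> = (\<chi> i k. A $ i $ \<beta> k)"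

definition select_entries :: "real^'n \<Rightarrow> ('k \<Rightarrow> 'n) \<Rightarrow> real^'k" where
  "select_entries c \<beta> = (\<chi> k. c $ \<beta> k)"


section \<open>Bases and basic solutions\<close>

text \<open>
  The square matrix \<open>A\<^sub>B\<close> needs an order on \<open>B\<close>, that is, a bijection from the row
  index type onto \<open>B\<close>, which exists if \<open>card B = CARD('m)\<close>. Its choice affects neither
  nonsingularity nor the dual basic solution and the reduced costs.
\<close>

definition basis_enum :: "'n set \<Rightarrow> 'm \<Rightarrow> 'n" where
  "basis_enum B = (SOME \<beta>. bij_betw \<beta> UNIV B)"

definition basis_matrix :: "real^'n^'m \<Rightarrow> 'n set \<Rightarrow> real^'m^'m" where
  "basis_matrix A B = select_columns A (basis_enum B)"

definition is_basis :: "real^'n^'m \<Rightarrow> 'n set \<Rightarrow> bool" where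
  "is_basis A B \<longleftrightarrow> card B = CARD('m) \<and> invertible (basis_matrix A B)"

definition dual_basic_solution :: "real^'n^'m \<Rightarrow> real^'n \<Rightarrow> 'n set \<Rightarrow> real^'m" where
  "dual_basic_solution A c B =
     select_entries c (basis_enum B) v* matrix_inv (basis_matrix A B)"

definition reduced_cost :: "real^'n^'m \<Rightarrow> real^'n \<Rightarrow> 'n set \<Rightarrow> real^'n" where
  "reduced_cost A c B = c - dual_basic_solution A c B v* A"


section \<open>Graphs and forest complexity\<close>

record 'a ugraph =
  vertices :: "'a set"
  edges :: "'a set set"

definition simple_graph :: "'a ugraph \<Rightarrow> bool" where
  "simple_graph G \<longleftrightarrow> finite (vertices G) \<and>
     (\<forall>e\<in>edges G. \<exists>u\<in>vertices G. \<exists>v\<in>vertices G. u \<noteq> v \<and> e = {u, v})"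

definition is_cycle :: "'a ugraph \<Rightarrow> 'a list \<Rightarrow> bool" where
  "is_cycle G vs \<longleftrightarrow> 3 \<le> length vs \<and> distinct vs \<and>
     (\<forall>i<length vs. {vs ! i, vs ! (Suc i mod length vs)} \<in> edges G)"

definition forest :: "'a ugraph \<Rightarrow> bool" where
  "forest F \<longleftrightarrow> simple_graph F \<and> (\<nexists>vs. is_cycle F vs)"

text \<open>The vertex sets of the connected components.\<close>

definition components :: "'a ugraph \<Rightarrow> 'a set set" where
  "components G = (\<lambda>u. {v. (u, v) \<in> {(x, y). {x, y} \<in> edges G}\<^sup>*}) ` vertices G"

definition forest_approximation :: "'a ugraph \<Rightarrow> ('a \<Rightarrow> 'b) \<Rightarrow> 'b ugraph \<Rightarrow> bool" where
  "forest_approximation G \<phi> F \<longleftrightarrow> forest F \<and> \<phi> ` vertices G \<subseteq> vertices F \<and>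
     (\<forall>u v. {u, v} \<in> edges G \<longrightarrow> \<phi> u = \<phi> v \<or> {\<phi> u, \<phi> v} \<in> edges F)"

definition fiber_card :: "'a ugraph \<Rightarrow> ('a \<Rightarrow> 'b) \<Rightarrow> 'b \<Rightarrow> nat" where
  "fiber_card G \<phi> u = card {x \<in> vertices G. \<phi> x = u}"

text \<open>An edge \<open>e = {u, v}\<close> has two elements, so the inner sum has the two terms for \<open>u\<close> and \<open>v\<close>.\<close>

definition approx_cost :: "'a ugraph \<Rightarrow> ('a \<Rightarrow> 'b) \<Rightarrow> 'b ugraph \<Rightarrow> nat" where
  "approx_cost G \<phi> F =
     (\<Sum>e\<in>edges F. (\<Sum>u\<in>e. fiber_card G \<phi> u)\<^sup>2) +
     (\<Sum>T\<in>components F. Min ((\<lambda>u. (fiber_card G \<phi> u)\<^sup>2) ` T))"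

text \<open>
  Every finite forest is isomorphic to one on a finite set of natural numbers, so forests with
  vertices in \<open>nat\<close> suffice. The minimum is attained: mapping all of \<open>G\<close> to a single vertex is a
  forest approximation.
\<close>

definition forest_complexity :: "'a ugraph \<Rightarrow> nat" where
  "forest_complexity G =
     (LEAST l. \<exists>(\<phi> :: 'a \<Rightarrow> nat) F. forest_approximation G \<phi> F \<and> l = approx_cost G \<phi> F)"


section \<open>Dependency graphs\<close>

text \<open>
  Independence of two families means independence of the two jointly distributed tuples.
\<close>

definition dependency_graph ::
  "'w measure \<Rightarrow> 'a measure \<Rightarrow> ('k \<Rightarrow> 'w \<Rightarrow> 'a) \<Rightarrow> 'k ugraph \<Rightarrow> bool" where
  "dependency_graph M N X G \<longleftrightarrow> simple_graph G \<and> vertices G = UNIV \<and>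
     (\<forall>I I'. I \<inter> I' = {} \<and> (\<forall>i\<in>I. \<forall>i'\<in>I'. {i, i'} \<notin> edges G) \<longrightarrow>
        prob_space.indep_var M
          (Pi\<^sub>M I (\<lambda>_. N)) (\<lambda>\<omega>. \<lambda>i\<in>I. X i \<omega>)
          (Pi\<^sub>M I' (\<lambda>_. N)) (\<lambda>\<omega>. \<lambda>i\<in>I'. X i \<omega>))"

end

theory Submission
  imports Defs
begin

text \<open>The dual basis depends on the sample, so a scalar bound for a fixed basis would need a
  union over all bases. Bounding the vector deviation avoids this; the price is the product of the
  norm bounds for \<open>l\<close> and \<open>g\<close>, which is C times 1 + m gamma |A|max in the
  first claim and C times chi in the second.

  Only leaves are conditioned on, because fixing a vertex with two neighbours could couple them.
  With \<open>n\<close> the block sizes, fixing a leaf v with parent p adds s^2 c^2 (n_v + n_p)^2 /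
  8 to the logarithm of the exponential moment, by Hoeffding's lemma. So every edge is paid once,
  and a root, left isolated at the end, pays only for its own block: this is the shape of the forest
  complexity. One index moves the norm of the deviation by at most c = 2R/K, and optimising s gives
  the second square root.

  All events depend only on the outcome \<open>\<lambda>k. J k \<omega>\<close>, which ranges over a
  finite type, so conditional expectations are finite sums.\<close>

text \<open>
  Let \<open>x\<close> be optimal for \<open>P_distr\<close> and \<open>h\<^sub>t = x\<^sub>t / \<xi>\<^sub>t \<in> [0, C]\<close>. For a dual optimal basis of \<open>P_J\<close>
  with reduced costs \<open>r\<close> (nonnegative on \<open>J\<close>), duality gives
  \<open>v(P_J) \<le> c\<^sup>T x + (1/K) \<Sum>\<^sub>k h(j\<^sub>k) r(j\<^sub>k) - \<Sum>\<^sub>t \<xi>\<^sub>t h\<^sub>t r\<^sub>t\<close>. Write \<open>h\<^sub>t r\<^sub>t = l \<bullet> g\<^sub>t\<close> where only \<open>l\<close> depends on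
  the basis. By Cauchy-Schwarz it remains to bound the norm of the deviation of the sample mean of
  \<open>g\<close> from its expectation, uniformly in the basis. Its mean is bounded by the second moment, in
  which only equal or adjacent pairs of indices contribute. Its fluctuation is bounded by a
  McDiarmid inequality for forests: condition on a leaf block. This keeps the dependency structure
  of the rest, and it moves the conditional expectation of a Lipschitz function by at most the
  sizes of the leaf block and the parent block, since all other blocks are independent of the leaf.
  The roots are chosen with the smallest block in their tree.
\<close>

section \<open>Finite weighted expectations\<close>

definition wexp :: "('w::finite \<Rightarrow> real) \<Rightarrow> ('w \<Rightarrow> real) \<Rightarrow> real" where
  "wexp q g = (\<Sum>w\<in>UNIV. q w * g w)"

definition prob_weight :: "('w::finite \<Rightarrow> real) \<Rightarrow> bool" where
  "prob_weight q \<longleftrightarrow> (\<forall>w. 0 \<le> q w) \<and> sum q UNIV = 1"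

definition depends_on :: "'k set \<Rightarrow> (('k \<Rightarrow> 'a) \<Rightarrow> 'b) \<Rightarrow> bool" where
  "depends_on I g \<longleftrightarrow> (\<forall>w w'. (\<forall>k\<in>I. w k = w' k) \<longrightarrow> g w = g w')"

text \<open>Factorisation over all functions of the two blocks, so that the indicator of a block
  value can be absorbed into one factor, as in \<open>indep_wrt_cond\<close>.\<close>

definition indep_wrt :: "(('k::finite \<Rightarrow> 'a::finite) \<Rightarrow> real) \<Rightarrow> 'k set \<Rightarrow> 'k set \<Rightarrow> bool" where
  "indep_wrt q I I' \<longleftrightarrow> (\<forall>g h. depends_on I g \<longrightarrow> depends_on I' h \<longrightarrow>
     wexp q (\<lambda>w. g w * h w) = wexp q g * wexp q h)"

text \<open>A block value is represented by a full outcome \<open>y\<close>, of which only the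
  restriction to \<open>B\<close> matters. Averaging over \<open>y\<close> under \<open>q\<close>
  then averages over block values.\<close>

definition agrees :: "'k set \<Rightarrow> ('k \<Rightarrow> 'a) \<Rightarrow> ('k \<Rightarrow> 'a) \<Rightarrow> real" where
  "agrees B y w = (if \<forall>k\<in>B. w k = y k then 1 else 0)"

text \<open>Division by zero turns a block value of weight zero into the zero weight; hence the
  recurring assumption that \<open>wexp q (agrees B y)\<close> is positive.\<close>

definition cond_weight :: "(('k::finite \<Rightarrow> 'a::finite) \<Rightarrow> real) \<Rightarrow> 'k set \<Rightarrow> ('k \<Rightarrow> 'a) \<Rightarrow> ('k \<Rightarrow> 'a) \<Rightarrow> real" where
  "cond_weight q B y w = agrees B y w * q w / wexp q (agrees B y)"

lemma wexp_mono: "prob_weight q \<Longrightarrow> (\<And>w. 0 < q w \<Longrightarrow> g w \<le> h w) \<Longrightarrow> wexp q g \<le> wexp q h"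
  unfolding wexp_def prob_weight_def
  by (intro sum_mono) (metis less_eq_real_def mult_left_mono mult_zero_left)

lemma wexp_cong: "(\<And>w. q w \<noteq> 0 \<Longrightarrow> g w = h w) \<Longrightarrow> wexp q g = wexp q h"
  unfolding wexp_def by (intro sum.cong) auto

lemma wexp_const: "prob_weight q \<Longrightarrow> wexp q (\<lambda>_. a) = a"
  by (simp add: wexp_def prob_weight_def flip: sum_distrib_right)

lemma wexp_add: "wexp q (\<lambda>w. g w + h w) = wexp q g + wexp q h"
  by (simp add: wexp_def distrib_left sum.distrib)

lemma wexp_diff: "wexp q (\<lambda>w. g w - h w) = wexp q g - wexp q h"
  by (simp add: wexp_def right_diff_distrib sum_subtractf)

lemma wexp_cmult: "wexp q (\<lambda>w. a * g w) = a * wexp q g"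
  by (simp add: wexp_def sum_distrib_left mult_ac)

lemma wexp_sum: "wexp q (\<lambda>w. \<Sum>i\<in>S. g i w) = (\<Sum>i\<in>S. wexp q (g i))"
  unfolding wexp_def sum_distrib_left by (rule sum.swap)

lemma wexp_nonneg: "prob_weight q \<Longrightarrow> (\<And>w. 0 \<le> g w) \<Longrightarrow> 0 \<le> wexp q g"
  by (simp add: wexp_def prob_weight_def sum_nonneg)

text \<open>The difference of the two sides is a variance.\<close>

lemma wexp_square_le:
  assumes "prob_weight q"
  shows "(wexp q g)\<^sup>2 \<le> wexp q (\<lambda>w. (g w)\<^sup>2)"
proof -
  define m where "m = wexp q g"
  have "0 \<le> wexp q (\<lambda>w. (g w - m)\<^sup>2)" using assms by (simp add: wexp_nonneg)
  also have "(\<lambda>w. (g w - m)\<^sup>2) = (\<lambda>w. ((g w)\<^sup>2 - (2*m) * g w) + m\<^sup>2)"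
    by (auto simp: power2_eq_square algebra_simps)
  also have "wexp q \<dots> = wexp q (\<lambda>w. (g w)\<^sup>2) - (2*m) * m + m\<^sup>2"
    using assms by (simp only: wexp_add wexp_diff wexp_cmult wexp_const m_def)
  finally show ?thesis by (simp add: m_def power2_eq_square)
qed

text \<open>The range is required on the support only, since conditional means are controlled only
  at outcomes of positive weight. The weight becomes a pmf, to which Hoeffding's lemma for the
  centred variable applies; the mean is put back at the end.\<close>

lemma Hoeffding_lemma_wexp:
  assumes q: "prob_weight q" and ab: "\<And>w. 0 < q w \<Longrightarrow> g w \<in> {a..b}" and l: "0 < l"
  shows "wexp q (\<lambda>w. exp (l * g w)) \<le> exp (l * wexp q g + l\<^sup>2 * (b - a)\<^sup>2 / 8)"
proof -
  have nonneg: "\<And>w. 0 \<le> q w" and sum1: "sum q UNIV = 1" using q by (auto simp: prob_weight_def)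
  have n1: "(\<integral>\<^sup>+x. ennreal (q x) \<partial>count_space UNIV) = 1"
    using nonneg sum1 by (simp add: nn_integral_count_space_finite sum_ennreal)
  define p where "p = embed_pmf q"
  have pmf_p: "pmf p x = q x" for x unfolding p_def by (rule pmf_embed_pmf[OF nonneg n1])
  have E: "measure_pmf.expectation p h = wexp q h" for h :: "_ \<Rightarrow> real"
    by (subst integral_measure_pmf_real[of UNIV]) (auto simp: pmf_p wexp_def mult.commute)
  interpret interval_bounded_random_variable "measure_pmf p" g a b
  proof
    show "AE x in measure_pmf p. g x \<in> {a..b}"
      using ab nonneg by (auto simp: AE_measure_pmf_iff set_pmf_eq pmf_p less_le)
  qed simp
  have "nn_integral p (\<lambda>x. ennreal (exp (l * (g x - wexp q g)))) \<le> ennreal (exp (l\<^sup>2 * (b - a)\<^sup>2 / 8))"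
    using Hoeffdings_lemma_nn_integral[OF l] by (simp add: E)
  also have "nn_integral p (\<lambda>x. ennreal (exp (l * (g x - wexp q g)))) =
      ennreal (measure_pmf.expectation p (\<lambda>x. exp (l * (g x - wexp q g))))"
    by (intro nn_integral_eq_integral integrable_measure_pmf_finite) auto
  finally have "wexp q (\<lambda>w. exp (l * (g w - wexp q g))) \<le> exp (l\<^sup>2 * (b - a)\<^sup>2 / 8)"
    by (simp add: E)
  moreover have "wexp q (\<lambda>w. exp (l * g w)) =
      exp (l * wexp q g) * wexp q (\<lambda>w. exp (l * (g w - wexp q g)))"
    by (subst wexp_cmult[symmetric]) (simp add: right_diff_distrib flip: exp_add)
  ultimately show ?thesis by (simp add: exp_add)
qed

section \<open>Independence of blocks and conditioning on the value of a block\<close>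

lemma depends_on_mono: "depends_on I g \<Longrightarrow> I \<subseteq> I' \<Longrightarrow> depends_on I' g"
  unfolding depends_on_def by blast

lemma depends_on_mult: "depends_on I g \<Longrightarrow> depends_on I h \<Longrightarrow> depends_on I (\<lambda>w. g w * h w :: real)"
  unfolding depends_on_def by metis

lemma depends_on_agrees: "depends_on B (agrees B y)"
  unfolding depends_on_def agrees_def by simp

lemma indep_wrt_sym: "indep_wrt q I I' \<Longrightarrow> indep_wrt q I' I"
  unfolding indep_wrt_def by (metis (no_types, lifting) mult.commute wexp_cong)

lemma wexp_agrees_ge: "prob_weight q \<Longrightarrow> q y \<le> wexp q (agrees B y)"
  unfolding wexp_def prob_weight_def
  using member_le_sum[of y UNIV "\<lambda>w. q w * agrees B y w"] by (simp add: agrees_def)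

lemma wexp_cond_weight:
  "wexp (cond_weight q B y) g = wexp q (\<lambda>w. agrees B y w * g w) / wexp q (agrees B y)"
  unfolding wexp_def cond_weight_def by (simp add: sum_divide_distrib mult_ac)

lemma prob_weight_cond:
  assumes "prob_weight q" "0 < wexp q (agrees B y)"
  shows "prob_weight (cond_weight q B y)"
proof -
  have "sum (cond_weight q B y) UNIV = wexp (cond_weight q B y) (\<lambda>_. 1)"
    by (simp add: wexp_def)
  also have "\<dots> = 1" using assms by (simp add: wexp_cond_weight)
  finally show ?thesis
    using assms by (auto simp: prob_weight_def cond_weight_def agrees_def)
qed

text \<open>After exchanging the sums, the weights of all \<open>y\<close> that agree with
  \<open>w\<close> on \<open>B\<close> add up to the normalising factor of \<open>w\<close>. An
  outcome of weight zero is treated apart, because its quotient may be 0/0.\<close>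

lemma wexp_tower:
  assumes "prob_weight q"
  shows "wexp q (\<lambda>y. wexp (cond_weight q B y) g) = wexp q g"
proof -
  \<comment> \<open>Agreement on \<open>B\<close> is symmetric, and agreeing outcomes have the same
    normalising factor.\<close>
  have sw: "agrees B y w / wexp q (agrees B y) = agrees B w y / wexp q (agrees B w)" for y w
  proof (cases "\<forall>k\<in>B. w k = y k")
    case True
    then have "agrees B y = agrees B w" by (auto simp: agrees_def fun_eq_iff)
    then show ?thesis using True by (simp add: agrees_def)
  next
    case False
    then have "\<not> (\<forall>k\<in>B. y k = w k)" by metis
    then have "agrees B y w = 0" "agrees B w y = 0" using False by (simp_all only: agrees_def if_False)
    then show ?thesis by simp
  qed
  have "wexp q (\<lambda>y. wexp (cond_weight q B y) g) =
      (\<Sum>y\<in>UNIV. \<Sum>w\<in>UNIV. (q w * g w) * (q y * (agrees B y w / wexp q (agrees B y))))"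
    by (simp add: wexp_cond_weight) (simp add: wexp_def sum_distrib_left sum_divide_distrib mult_ac)
  also have "\<dots> = (\<Sum>w\<in>UNIV. \<Sum>y\<in>UNIV. (q w * g w) * (q y * agrees B w y / wexp q (agrees B w)))"
    by (subst sum.swap) (simp add: sw)
  also have "\<dots> = (\<Sum>w\<in>UNIV. (q w * g w) * (wexp q (agrees B w) / wexp q (agrees B w)))"
  proof (intro sum.cong refl)
    fix w
    have "wexp q (agrees B w) = (\<Sum>y\<in>UNIV. q y * agrees B w y)" by (simp add: wexp_def)
    then show "(\<Sum>y\<in>UNIV. (q w * g w) * (q y * agrees B w y / wexp q (agrees B w))) =
        (q w * g w) * (wexp q (agrees B w) / wexp q (agrees B w))"
      by (simp only: sum_distrib_left[symmetric] sum_divide_distrib[symmetric])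
  qed
  also have "\<dots> = (\<Sum>w\<in>UNIV. q w * g w)"
  proof (intro sum.cong refl)
    fix w
    show "(q w * g w) * (wexp q (agrees B w) / wexp q (agrees B w)) = q w * g w"
    proof (cases "q w = 0")
      case False
      then have "0 < q w" using assms by (simp add: prob_weight_def less_le)
      then show ?thesis using wexp_agrees_ge[OF assms, of w B] by simp
    qed simp
  qed
  finally show ?thesis by (simp add: wexp_def)
qed

lemma wexp_cond_indep:
  assumes "indep_wrt q B I" "depends_on I h" "0 < wexp q (agrees B y)"
  shows "wexp (cond_weight q B y) h = wexp q h"
proof -
  have "wexp q (\<lambda>w. agrees B y w * h w) = wexp q (agrees B y) * wexp q h"
    using assms(1,2) depends_on_agrees unfolding indep_wrt_def by blast
  then show ?thesis using assms(3) by (simp add: wexp_cond_weight)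
qed

text \<open>The indicator of the fixed value of \<open>B\<close> multiplies the function of
  \<open>I\<close>, and the product is still independent of \<open>I'\<close>. Hence
  \<open>B\<close> has to sit on one side of the assumed independence.\<close>

lemma indep_wrt_cond:
  assumes ind: "indep_wrt q (I \<union> B) I'" and pos: "0 < wexp q (agrees B y)"
  shows "indep_wrt (cond_weight q B y) I I'"
  unfolding indep_wrt_def
proof (intro allI impI)
  fix g h :: "('a \<Rightarrow> 'b) \<Rightarrow> real" assume g: "depends_on I g" and h: "depends_on I' h"
  have dB: "depends_on (I \<union> B) (agrees B y)"
    by (rule depends_on_mono[OF depends_on_agrees]) simp
  have dg: "depends_on (I \<union> B) (\<lambda>w. agrees B y w * g w)"
    by (intro depends_on_mult dB depends_on_mono[OF g]) simp
  have 1: "wexp q (\<lambda>w. (agrees B y w * g w) * h w) = wexp q (\<lambda>w. agrees B y w * g w) * wexp q h"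
    using ind dg h unfolding indep_wrt_def by blast
  have 2: "wexp q (\<lambda>w. agrees B y w * h w) = wexp q (agrees B y) * wexp q h"
    using ind dB h unfolding indep_wrt_def by blast
  show "wexp (cond_weight q B y) (\<lambda>w. g w * h w) =
        wexp (cond_weight q B y) g * wexp (cond_weight q B y) h"
    using pos 1 2 by (simp add: wexp_cond_weight mult.assoc)
qed

text \<open>\<open>B\<close> is the block being fixed, \<open>P\<close> its parent block,
  \<open>I\<close> the rest. Fixing \<open>B\<close> may shift the law of \<open>P\<close>
  arbitrarily, so both are minimised out: the lower envelope \<open>low\<close> depends on
  \<open>I\<close> only, and its conditional mean does not move. As \<open>f\<close> exceeds
  \<open>low\<close> by at most \<open>c\<close> times the size of \<open>B \<union> P\<close>, the
  conditional means of \<open>f\<close> lie in one interval of that length. Hoeffding's lemma and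
  the tower rule give the extra term.\<close>

lemma mgf_condition_step:
  fixes q :: "('k::finite \<Rightarrow> 'a::finite) \<Rightarrow> real"
  assumes q: "prob_weight q" and s: "0 < s"
    and lip: "\<And>w w'. f w - f w' \<le> c * real (card {k. w k \<noteq> w' k})" and c: "0 \<le> c"
    and dep: "depends_on (B \<union> P \<union> I) f" and ind: "indep_wrt q B I"
    and IH: "\<And>y. 0 < wexp q (agrees B y) \<Longrightarrow>
      wexp (cond_weight q B y) (\<lambda>w. exp (s * f w)) \<le> exp (s * wexp (cond_weight q B y) f + \<kappa>)"
  shows "wexp q (\<lambda>w. exp (s * f w)) \<le>
    exp (s * wexp q f + (\<kappa> + s\<^sup>2 * (c * real (card (B \<union> P)))\<^sup>2 / 8))"
proof -
  define near where "near w = {w'. \<forall>k. k \<notin> B \<union> P \<longrightarrow> w' k = w k}" for w :: "'k \<Rightarrow> 'a"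
  define low where "low w = Min (f ` near w)" for w
  define d where "d = c * real (card (B \<union> P))"
  have self: "w \<in> near w" for w by (simp add: near_def)
  have low_le: "low w \<le> f w" for w unfolding low_def by (intro Min_le) (auto intro: self)
  have le_low: "f w \<le> low w + d" for w
  proof -
    have "low w \<in> f ` near w" unfolding low_def using self by (intro Min_in) auto
    then obtain w' where w': "w' \<in> near w" "low w = f w'" by auto
    have "card {k. w k \<noteq> w' k} \<le> card (B \<union> P)"
      using w'(1) by (intro card_mono) (auto simp: near_def)
    then have "c * real (card {k. w k \<noteq> w' k}) \<le> d"
      unfolding d_def using c by (intro mult_left_mono) auto
    then show ?thesis using lip[of w w'] w'(2) by simp
  qed
  have low_dep: "depends_on I low"
    unfolding depends_on_def
  proof (intro allI impI)
    fix w w' :: "'k \<Rightarrow> 'a" assume eq: "\<forall>k\<in>I. w k = w' k"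
    have *: "f ` near u \<subseteq> f ` near u'" if "\<forall>k\<in>I. u k = u' k" for u u' :: "'k \<Rightarrow> 'a"
    proof
      fix z assume "z \<in> f ` near u"
      then obtain x where x: "x \<in> near u" "z = f x" by auto
      \<comment> \<open>The minimisation fixes all coordinates outside \<open>B \<union> P\<close>,
        not just those in \<open>I\<close>; the witness is therefore \<open>u'\<close> with the
        entries of \<open>x\<close> on \<open>B \<union> P\<close>.\<close>
      let ?x = "\<lambda>k. if k \<in> B \<union> P then x k else u' k"
      have "f x = f ?x"
        using x(1) that by (intro dep[unfolded depends_on_def, rule_format]) (auto simp: near_def)
      moreover have "?x \<in> near u'" by (auto simp: near_def)
      ultimately show "z \<in> f ` near u'" using x(2) by blast
    qed
    have "f ` near w = f ` near w'" using *[of w w'] *[of w' w] eq by auto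
    then show "low w = low w'" by (simp add: low_def)
  qed
  define m where "m y = wexp (cond_weight q B y) f" for y
  define L where "L = wexp q low"
  have pos: "0 < wexp q (agrees B y)" if "0 < q y" for y
    using wexp_agrees_ge[OF q, of y B] that by simp
  have m_bd: "m y \<in> {L..L + d}" if "0 < q y" for y
  proof -
    let ?q = "cond_weight q B y"
    have pw: "prob_weight ?q" by (rule prob_weight_cond[OF q pos[OF that]])
    have eq: "wexp ?q low = L" unfolding L_def by (rule wexp_cond_indep[OF ind low_dep pos[OF that]])
    have "wexp ?q low \<le> m y" unfolding m_def by (rule wexp_mono[OF pw low_le])
    moreover have "m y \<le> wexp ?q (\<lambda>w. low w + d)" unfolding m_def by (rule wexp_mono[OF pw le_low])
    ultimately show ?thesis using eq by (simp add: wexp_add wexp_const[OF pw])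
  qed
  have "wexp q (\<lambda>w. exp (s * f w)) = wexp q (\<lambda>y. wexp (cond_weight q B y) (\<lambda>w. exp (s * f w)))"
    by (rule wexp_tower[OF q, symmetric])
  also have "\<dots> \<le> wexp q (\<lambda>y. exp \<kappa> * exp (s * m y))"
    using IH[OF pos] by (intro wexp_mono[OF q]) (simp add: m_def exp_add mult.commute)
  also have "\<dots> = exp \<kappa> * wexp q (\<lambda>y. exp (s * m y))" by (rule wexp_cmult)
  also have "\<dots> \<le> exp \<kappa> * exp (s * wexp q m + s\<^sup>2 * (L + d - L)\<^sup>2 / 8)"
    by (intro mult_left_mono Hoeffding_lemma_wexp[OF q m_bd s]) auto
  also have "wexp q m = wexp q f" unfolding m_def by (rule wexp_tower[OF q])
  finally show ?thesis by (simp add: d_def flip: exp_add add: algebra_simps)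
qed

section \<open>Rooted forests\<close>

definition remove_vertex :: "'b ugraph \<Rightarrow> 'b \<Rightarrow> 'b ugraph" where
  "remove_vertex F v = \<lparr>vertices = vertices F - {v}, edges = {e \<in> edges F. v \<notin> e}\<rparr>"

definition adjacency :: "'b ugraph \<Rightarrow> ('b \<times> 'b) set" where
  "adjacency F = {(x, y). {x, y} \<in> edges F}"

lemma simple_graph_edgeD:
  assumes "simple_graph F" "{u, v} \<in> edges F"
  shows "u \<in> vertices F" "v \<in> vertices F" "u \<noteq> v"
proof -
  obtain x y where "x \<in> vertices F" "y \<in> vertices F" "x \<noteq> y" "{u, v} = {x, y}"
    using assms unfolding simple_graph_def by metis
  then show "u \<in> vertices F" "v \<in> vertices F" "u \<noteq> v"
    by (auto simp: doubleton_eq_iff)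
qed

lemma simple_graph_edge_other:
  assumes "simple_graph F" "e \<in> edges F" "v \<in> e"
  shows "\<exists>z. e = {v, z}"
proof -
  have "\<exists>x\<in>vertices F. \<exists>y\<in>vertices F. x \<noteq> y \<and> e = {x, y}"
    using assms(1,2) by (simp add: simple_graph_def)
  then show ?thesis using assms(3) by blast
qed

lemma simple_graph_finite_edges: "simple_graph F \<Longrightarrow> finite (edges F)"
  by (rule finite_subset[of _ "Pow (vertices F)"]) (auto simp: simple_graph_def)

lemma forest_remove_vertex:
  assumes "forest F"
  shows "forest (remove_vertex F v)"
proof -
  have "simple_graph (remove_vertex F v)"
    using assms unfolding forest_def simple_graph_def remove_vertex_def by fastforce
  moreover have "is_cycle F vs" if "is_cycle (remove_vertex F v) vs" for vs
    using that by (auto simp: is_cycle_def remove_vertex_def)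
  ultimately show ?thesis using assms by (auto simp: forest_def)
qed

text \<open>The far end of a longest path from \<open>r\<close> is a leaf, since a second neighbour would close a cycle.\<close>

lemma forest_leaf_exists:
  assumes F: "forest F" and ru: "{r, u} \<in> edges F"
  obtains v p where "v \<noteq> r" "(r, v) \<in> (adjacency F)\<^sup>*" "{v, p} \<in> edges F"
    "\<And>u. {v, u} \<in> edges F \<Longrightarrow> u = p"
proof -
  have sg: "simple_graph F" and fin: "finite (vertices F)"
    using F by (auto simp: forest_def simple_graph_def)
  \<comment> \<open>Paths start at \<open>r\<close>, so the leaf found lies in the tree of
    \<open>r\<close>. A longest one has at least the two vertices of \<open>[r, u]\<close>, so its
    far end is not \<open>r\<close>, the root that has to survive.\<close>
  define path where "path xs \<longleftrightarrow> xs \<noteq> [] \<and> hd xs = r \<and> distinct xs \<and> set xs \<subseteq> vertices F \<and>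
    (\<forall>i. Suc i < length xs \<longrightarrow> {xs ! i, xs ! Suc i} \<in> edges F)" for xs
  have p2: "path [r, u]"
    using simple_graph_edgeD[OF sg ru] ru by (simp add: path_def)
  have bd: "\<forall>xs. path xs \<longrightarrow> length xs < Suc (card (vertices F))"
    using fin by (auto simp: path_def less_Suc_eq_le distinct_card[symmetric] intro!: card_mono)
  obtain xs where xs: "path xs" and mx: "\<And>ys. path ys \<Longrightarrow> length ys \<le> length xs"
    using ex_has_greatest_nat[of path, OF p2 bd] by blast
  define n where "n = length xs"
  have n2: "2 \<le> n" using mx[OF p2] by (simp add: n_def)
  have ne: "xs \<noteq> []" and hd: "xs ! 0 = r" and dist: "distinct xs" and sub: "set xs \<subseteq> vertices F"
    and ed: "\<And>i. Suc i < n \<Longrightarrow> {xs ! i, xs ! Suc i} \<in> edges F"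
    using xs by (auto simp: path_def n_def hd_conv_nth)
  define v where "v = xs ! (n - 1)"
  define p where "p = xs ! (n - 2)"
  have reach: "i < n \<Longrightarrow> (r, xs ! i) \<in> (adjacency F)\<^sup>*" for i
  proof (induction i)
    case (Suc i)
    then have "(xs ! i, xs ! Suc i) \<in> adjacency F" using ed by (simp add: adjacency_def)
    with Suc show ?case by (meson Suc_lessD rtrancl.rtrancl_into_rtrancl)
  qed (simp add: hd)
  have "v \<noteq> r"
    using n2 ne hd nth_eq_iff_index_eq[OF dist, of "n - 1" 0] by (auto simp: v_def n_def)
  moreover have "(r, v) \<in> (adjacency F)\<^sup>*" unfolding v_def using n2 by (intro reach) simp
  moreover have "{v, p} \<in> edges F"
  proof -
    have "Suc (n - 2) = n - 1" using n2 by simp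
    then show ?thesis using ed[of "n - 2"] n2 by (simp add: v_def p_def insert_commute)
  qed
  moreover have "w = p" if vw: "{v, w} \<in> edges F" for w
  proof -
    have wV: "w \<in> vertices F" and "w \<noteq> v" using simple_graph_edgeD[OF sg vw] by auto
    have "w \<in> set xs"
    proof (rule ccontr)
      assume w: "w \<notin> set xs"
      have "{(xs @ [w]) ! i, (xs @ [w]) ! Suc i} \<in> edges F" if "Suc i < length (xs @ [w])" for i
      proof (cases "Suc i < n")
        case True
        then show ?thesis using ed by (simp add: nth_append n_def)
      next
        case False
        then have "Suc i = n" using that by (simp add: n_def)
        then have "i = n - 1" "i < n" by simp_all
        then have "(xs @ [w]) ! i = v" "(xs @ [w]) ! Suc i = w"
          using \<open>Suc i = n\<close> by (simp_all add: nth_append n_def v_def)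
        then show ?thesis using vw by simp
      qed
      then have "path (xs @ [w])"
        using w wV ne dist sub xs by (auto simp: path_def)
      then show False using mx by fastforce
    qed
    then obtain j where j: "j < n" "w = xs ! j" by (auto simp: in_set_conv_nth n_def)
    show ?thesis
    proof (cases "j = n - 2")
      case False
      have "j \<noteq> n - 1" using j \<open>w \<noteq> v\<close> by (auto simp: v_def)
      then have j3: "j + 3 \<le> n" using False j by simp
      \<comment> \<open>The tail of the path from \<open>w\<close> to \<open>v\<close> is closed by
        the edge between \<open>v\<close> and \<open>w\<close>; \<open>j + 3 \<le> n\<close>
        provides the three vertices that \<open>is_cycle\<close> demands.\<close>
      let ?c = "drop j xs"
      have len: "length ?c = n - j" by (simp add: n_def)
      have "{?c ! i, ?c ! (Suc i mod length ?c)} \<in> edges F" if i: "i < length ?c" for i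
      proof (cases "Suc i < length ?c")
        case True
        then show ?thesis using ed[of "j + i"] by (simp add: n_def)
      next
        case False
        then have "Suc i = length ?c" using i by simp
        moreover have "j + i = n - 1" using False i len by simp
        ultimately show ?thesis using vw j len i by (simp add: v_def n_def)
      qed
      then have "is_cycle F ?c" using dist j3 len by (simp add: is_cycle_def)
      then show ?thesis using F by (auto simp: forest_def)
    qed (simp add: j p_def)
  qed
  ultimately show ?thesis using that by blast
qed

text \<open>A walk enters and leaves \<open>v\<close> only through \<open>p\<close>, so detours
  through \<open>v\<close> can be cut. The conditional endpoint is the induction invariant: a walk
  that is currently at \<open>v\<close> counts as being at \<open>p\<close>.\<close>

lemma reach_remove_leaf:
  assumes leaf: "\<And>u. {v, u} \<in> edges F \<Longrightarrow> u = p" and ne: "u \<noteq> v"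
    and reach: "(u, w) \<in> (adjacency F)\<^sup>*"
  shows "(u, if w = v then p else w) \<in> (adjacency (remove_vertex F v))\<^sup>*"
  using reach
proof (induction rule: rtrancl_induct)
  case base
  then show ?case using ne by simp
next
  case (step y z)
  then have yz: "{y, z} \<in> edges F" by (simp add: adjacency_def)
  show ?case
  proof (cases "y = v \<or> z = v")
    case True
    then show ?thesis using step.IH yz leaf by (auto simp: insert_commute split: if_splits)
  next
    case False
    then have "(y, z) \<in> adjacency (remove_vertex F v)"
      using yz by (auto simp: adjacency_def remove_vertex_def)
    then show ?thesis using step.IH False by (auto intro: rtrancl_into_rtrancl)
  qed
qed

section \<open>Concentration under a dependency forest\<close>

text \<open>\<open>approx_cost\<close> with chosen roots in place of the minimum over each tree; in
  this form it loses exactly one summand with each vertex removed in the induction.\<close>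

definition rooted_cost :: "'b ugraph \<Rightarrow> 'b set \<Rightarrow> ('b \<Rightarrow> nat) \<Rightarrow> nat" where
  "rooted_cost F R n = (\<Sum>e\<in>edges F. (\<Sum>u\<in>e. n u)\<^sup>2) + (\<Sum>r\<in>R. (n r)\<^sup>2)"

text \<open>One root in each tree, expressed by reachability so that it passes to the forest without
  a leaf by \<open>reach_remove_leaf\<close>.\<close>

definition root_set :: "'b ugraph \<Rightarrow> 'b set \<Rightarrow> bool" where
  "root_set F R \<longleftrightarrow> R \<subseteq> vertices F \<and> (\<forall>u\<in>vertices F. \<exists>r\<in>R. (u, r) \<in> (adjacency F)\<^sup>*) \<and>
     (\<forall>r\<in>R. \<forall>r'\<in>R. (r, r') \<in> (adjacency F)\<^sup>* \<longrightarrow> r = r')"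

text \<open>The dependency graph property for fibres of \<open>\<phi>\<close>, asserted for vertices
  of \<open>F\<close> only: after \<open>remove_vertex\<close> it no longer speaks of blocks that
  have been conditioned on.\<close>

definition block_dependency ::
  "(('k::finite \<Rightarrow> 'a::finite) \<Rightarrow> real) \<Rightarrow> ('k \<Rightarrow> 'b) \<Rightarrow> 'b ugraph \<Rightarrow> bool" where
  "block_dependency q \<phi> F \<longleftrightarrow> (\<forall>S S'. S \<subseteq> vertices F \<and> S' \<subseteq> vertices F \<and> S \<inter> S' = {} \<and>
     (\<forall>u\<in>S. \<forall>u'\<in>S'. {u, u'} \<notin> edges F) \<longrightarrow> indep_wrt q (\<phi> -` S) (\<phi> -` S'))"

text \<open>
  A vertex with at most one neighbour lies next to at most one of two separated vertex sets, so
  fixing its block leaves the remaining dependencies intact.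
\<close>

lemma block_dependency_cond:
  assumes dep: "block_dependency q \<phi> F" and v: "v \<in> vertices F"
    and leaf: "\<And>u. {v, u} \<in> edges F \<Longrightarrow> u = p"
    and pos: "0 < wexp q (agrees (\<phi> -` {v}) y)"
  shows "block_dependency (cond_weight q (\<phi> -` {v}) y) \<phi> (remove_vertex F v)"
  unfolding block_dependency_def
proof (intro allI impI, elim conjE)
  fix S S' assume S: "S \<subseteq> vertices (remove_vertex F v)" "S' \<subseteq> vertices (remove_vertex F v)"
    and dis: "S \<inter> S' = {}" and non: "\<forall>u\<in>S. \<forall>u'\<in>S'. {u, u'} \<notin> edges (remove_vertex F v)"
  have *: "indep_wrt (cond_weight q (\<phi> -` {v}) y) (\<phi> -` T) (\<phi> -` T')"
    if T: "T \<subseteq> vertices (remove_vertex F v)" "T' \<subseteq> vertices (remove_vertex F v)" "T \<inter> T' = {}"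
      and non: "\<forall>u\<in>T. \<forall>u'\<in>T'. {u, u'} \<notin> edges (remove_vertex F v)" and p: "p \<notin> T'" for T T'
  proof -
    have "indep_wrt q (\<phi> -` insert v T) (\<phi> -` T')"
      using dep[unfolded block_dependency_def, rule_format, of "insert v T" T'] T non p v leaf
      by (fastforce simp: remove_vertex_def)
    moreover have "\<phi> -` insert v T = \<phi> -` T \<union> \<phi> -` {v}" by auto
    ultimately show ?thesis using indep_wrt_cond[OF _ pos] by metis
  qed
  show "indep_wrt (cond_weight q (\<phi> -` {v}) y) (\<phi> -` S) (\<phi> -` S')"
  proof (cases "p \<in> S'")
    case True
    then have "p \<notin> S" using dis by auto
    have non': "\<forall>u\<in>S'. \<forall>u'\<in>S. {u, u'} \<notin> edges (remove_vertex F v)"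
      using non by (metis insert_commute)
    from \<open>p \<notin> S\<close> have "indep_wrt (cond_weight q (\<phi> -` {v}) y) (\<phi> -` S') (\<phi> -` S)"
      using S dis non' by (intro *) auto
    then show ?thesis by (rule indep_wrt_sym)
  next
    case False
    then show ?thesis using S dis non by (intro *) auto
  qed
qed

text \<open>Each removed vertex pays one summand of \<open>rooted_cost\<close>: a leaf that is not a
  root pays for its edge, and once only roots remain each pays for its own block. The induction
  generalises over \<open>q\<close> and \<open>f\<close>, since conditioning changes the weight and
  freezes a block of the function.\<close>

lemma forest_mgf_bound:
  fixes q :: "('k::finite \<Rightarrow> 'a::finite) \<Rightarrow> real" and F :: "'b ugraph"
  assumes "forest F" "root_set F R" "prob_weight q" "block_dependency q \<phi> F"
    and "depends_on (\<phi> -` vertices F) f"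
    and "\<And>w w'. f w - f w' \<le> c * real (card {k. w k \<noteq> w' k})" and "0 \<le> c" and "0 < s"
  shows "wexp q (\<lambda>w. exp (s * f w)) \<le>
    exp (s * wexp q f + s\<^sup>2 * c\<^sup>2 * real (rooted_cost F R (\<lambda>u. card (\<phi> -` {u}))) / 8)"
  using assms
proof (induction "card (vertices F)" arbitrary: F R q f)
  case 0
  then have "vertices F = {}" by (auto simp: forest_def simple_graph_def)
  then have "f w = f (\<lambda>_. undefined)" for w
    using 0 unfolding depends_on_def by auto
  then have "f = (\<lambda>_. f (\<lambda>_. undefined))" by (intro ext)
  then obtain a where a: "f = (\<lambda>_. a)" by blast
  show ?case using 0 by (simp add: a wexp_const)
next
  case (Suc N)
  define n where "n = (\<lambda>u. card (\<phi> -` {u}))"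
  note lip = Suc.prems(6)
  have sg: "simple_graph F" and fin: "finite (vertices F)" and finE: "finite (edges F)"
    using Suc.prems(1) simple_graph_finite_edges by (auto simp: forest_def simple_graph_def)
  have RV: "R \<subseteq> vertices F" and finR: "finite R"
    and reach: "\<And>u. u \<in> vertices F \<Longrightarrow> \<exists>r\<in>R. (u, r) \<in> (adjacency F)\<^sup>*"
    and uniq: "\<And>r r'. r \<in> R \<Longrightarrow> r' \<in> R \<Longrightarrow> (r, r') \<in> (adjacency F)\<^sup>* \<Longrightarrow> r = r'"
    using Suc.prems(2) fin finite_subset by (auto simp: root_set_def)
  have adj_mono: "(adjacency (remove_vertex F v))\<^sup>* \<subseteq> (adjacency F)\<^sup>*" for v
    by (intro rtrancl_mono) (auto simp: adjacency_def remove_vertex_def)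
  \<comment> \<open>Shared by both kinds of removal: \<open>P\<close> is \<open>{p}\<close> for a
    leaf below \<open>p\<close> and \<open>{}\<close> for an isolated root. Block sizes are always
    counted in the full index set, so the remaining summands do not change.\<close>
  have step: ?case
    if v: "v \<in> vertices F" and leaf: "\<And>u. {v, u} \<in> edges F \<Longrightarrow> u = p"
      and R': "root_set (remove_vertex F v) R'"
      and P: "\<And>u. {v, u} \<in> edges F \<Longrightarrow> u \<in> P"
      and cost: "rooted_cost F R n = rooted_cost (remove_vertex F v) R' n +
        (card (\<phi> -` {v} \<union> \<phi> -` P))\<^sup>2" for v p R' P
  proof -
    let ?B = "\<phi> -` {v}" and ?F = "remove_vertex F v"
    define \<kappa> where "\<kappa> = s\<^sup>2 * c\<^sup>2 * real (rooted_cost ?F R' n) / 8"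
    have "wexp q (\<lambda>w. exp (s * f w)) \<le>
        exp (s * wexp q f + (\<kappa> + s\<^sup>2 * (c * real (card (?B \<union> \<phi> -` P)))\<^sup>2 / 8))"
    proof (rule mgf_condition_step[where I = "\<phi> -` (vertices F - insert v P)",
          OF Suc.prems(3,8) lip Suc.prems(7)])
      show "depends_on (?B \<union> \<phi> -` P \<union> \<phi> -` (vertices F - insert v P)) f"
        by (rule depends_on_mono[OF Suc.prems(5)]) auto
      show "indep_wrt q ?B (\<phi> -` (vertices F - insert v P))"
        using Suc.prems(4)[unfolded block_dependency_def, rule_format,
            of "{v}" "vertices F - insert v P"] v P by auto
      fix y assume pos: "0 < wexp q (agrees ?B y)"
      let ?q = "cond_weight q ?B y"
      \<comment> \<open>\<open>fy\<close> is \<open>f\<close> with the fixed block frozen at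
        \<open>y\<close>. It equals \<open>f\<close> on the support of the conditional weight but
        depends on the remaining blocks only, as the induction hypothesis requires.\<close>
      define fy where "fy w = f (\<lambda>k. if k \<in> ?B then y k else w k)" for w
      have eq: "fy w = f w" if "?q w \<noteq> 0" for w
      proof -
        have "\<forall>k\<in>?B. w k = y k" using that by (auto simp: cond_weight_def agrees_def split: if_splits)
        then have "(\<lambda>k. if k \<in> ?B then y k else w k) = w" by auto
        then show ?thesis by (simp add: fy_def)
      qed
      have "wexp ?q (\<lambda>w. exp (s * fy w)) \<le> exp (s * wexp ?q fy + \<kappa>)"
        unfolding \<kappa>_def n_def
      proof (rule Suc.hyps(1))
        show "N = card (vertices ?F)" using Suc.hyps(2) v fin by (simp add: remove_vertex_def)
        show "forest ?F" by (rule forest_remove_vertex[OF Suc.prems(1)])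
        show "root_set ?F R'" by (rule R')
        show "prob_weight ?q" by (rule prob_weight_cond[OF Suc.prems(3) pos])
        show "block_dependency ?q \<phi> ?F" by (rule block_dependency_cond[OF Suc.prems(4) v leaf pos])
        show "depends_on (\<phi> -` vertices ?F) fy"
          unfolding depends_on_def
        proof (intro allI impI)
          fix w w' :: "'k \<Rightarrow> 'a" assume "\<forall>k\<in>\<phi> -` vertices ?F. w k = w' k"
          then show "fy w = fy w'" unfolding fy_def
            by (intro Suc.prems(5)[unfolded depends_on_def, rule_format]) (auto simp: remove_vertex_def)
        qed
        fix w w'
        let ?w = "\<lambda>k. if k \<in> ?B then y k else w k" and ?w' = "\<lambda>k. if k \<in> ?B then y k else w' k"
        have "card {k. ?w k \<noteq> ?w' k} \<le> card {k. w k \<noteq> w' k}" by (intro card_mono) auto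
        then show "fy w - fy w' \<le> c * real (card {k. w k \<noteq> w' k})"
          using lip[of ?w ?w'] mult_left_mono[OF _ Suc.prems(7), of "real (card {k. ?w k \<noteq> ?w' k})"]
          unfolding fy_def by (meson of_nat_mono order_trans)
      qed (use Suc.prems in auto)
      moreover have "wexp ?q fy = wexp ?q f" by (intro wexp_cong eq)
      moreover have "wexp ?q (\<lambda>w. exp (s * fy w)) = wexp ?q (\<lambda>w. exp (s * f w))"
        by (intro wexp_cong) (simp add: eq)
      ultimately show "wexp ?q (\<lambda>w. exp (s * f w)) \<le> exp (s * wexp ?q f + \<kappa>)" by simp
    qed
    also have "\<kappa> + s\<^sup>2 * (c * real (card (?B \<union> \<phi> -` P)))\<^sup>2 / 8 = s\<^sup>2 * c\<^sup>2 * real (rooted_cost F R n) / 8"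
      unfolding \<kappa>_def cost by (simp add: power_mult_distrib field_simps)
    finally show ?thesis by (simp add: n_def)
  qed
  show ?case
  \<comment> \<open>If some root has an edge, its tree has a leaf other than the root. If none has,
    every vertex is a root, because a path from elsewhere would end with an edge at a root.\<close>
  proof (cases "\<exists>r\<in>R. \<exists>u. {r, u} \<in> edges F")
    case True
    then obtain r u where r: "r \<in> R" and ru: "{r, u} \<in> edges F" by auto
    obtain v p where vr: "v \<noteq> r" and rv: "(r, v) \<in> (adjacency F)\<^sup>*" and vp: "{v, p} \<in> edges F"
      and leaf: "\<And>u. {v, u} \<in> edges F \<Longrightarrow> u = p"
      using forest_leaf_exists[OF Suc.prems(1) ru] by metis
    have v: "v \<in> vertices F" and vnp: "v \<noteq> p" using simple_graph_edgeD[OF sg vp] by auto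
    have vR: "v \<notin> R" using uniq[OF r _ rv] vr by auto
    have reach_v: "(w, r') \<in> (adjacency (remove_vertex F v))\<^sup>*"
      if "w \<noteq> v" "r' \<in> R" "(w, r') \<in> (adjacency F)\<^sup>*" for w r'
    proof -
      have "r' \<noteq> v" using that(2) vR by blast
      then show ?thesis using reach_remove_leaf[OF leaf that(1,3)] by simp
    qed
    have "root_set (remove_vertex F v) R"
      unfolding root_set_def
    proof (intro conjI ballI impI)
      show "R \<subseteq> vertices (remove_vertex F v)" using RV vR by (auto simp: remove_vertex_def)
      fix w assume w: "w \<in> vertices (remove_vertex F v)"
      then obtain r' where r': "r' \<in> R" "(w, r') \<in> (adjacency F)\<^sup>*"
        using reach by (auto simp: remove_vertex_def)
      then show "\<exists>r\<in>R. (w, r) \<in> (adjacency (remove_vertex F v))\<^sup>*"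
        by (intro bexI[of _ r'] reach_v) (use w in \<open>simp add: remove_vertex_def\<close>)
    next
      fix r1 r2 assume "r1 \<in> R" "r2 \<in> R" "(r1, r2) \<in> (adjacency (remove_vertex F v))\<^sup>*"
      then show "r1 = r2" using uniq adj_mono by blast
    qed
    moreover have "edges F = insert {v, p} (edges (remove_vertex F v))"
      "{v, p} \<notin> edges (remove_vertex F v)"
    proof -
      have "e = {v, p}" if e: "e \<in> edges F" "v \<in> e" for e
      proof -
        obtain z where z: "e = {v, z}" using simple_graph_edge_other[OF sg e] by blast
        then have "z = p" using leaf e(1) by blast
        with z show ?thesis by simp
      qed
      then have "{e \<in> edges F. v \<in> e} = {{v, p}}" using vp by blast
      moreover have "edges F = {e \<in> edges F. v \<in> e} \<union> edges (remove_vertex F v)"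
        unfolding remove_vertex_def by auto
      ultimately show "edges F = insert {v, p} (edges (remove_vertex F v))" by simp
    qed (simp add: remove_vertex_def)
    then have "rooted_cost F R n = rooted_cost (remove_vertex F v) R n + (\<Sum>u\<in>{v, p}. n u)\<^sup>2"
      using finE by (simp add: rooted_cost_def)
    moreover have "(\<Sum>u\<in>{v, p}. n u) = card (\<phi> -` {v} \<union> \<phi> -` {p})"
      using vnp by (subst card_Un_disjoint) (auto simp: n_def)
    ultimately show ?thesis using step[OF v leaf, of R "{p}"] leaf by (simp only: singleton_iff)
  next
    case False
    have VR: "vertices F = R"
    proof
      show "vertices F \<subseteq> R"
      proof
        fix u assume "u \<in> vertices F"
        then obtain r where r: "r \<in> R" "(u, r) \<in> (adjacency F)\<^sup>*" using reach by auto
        from r(2) show "u \<in> R"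
        proof (cases rule: rtranclE)
          case (step y)
          then have "{r, y} \<in> edges F" by (simp add: adjacency_def insert_commute)
          then show ?thesis using False r(1) by blast
        qed (use r(1) in simp)
      qed
    qed (rule RV)
    obtain v where v: "v \<in> vertices F" using Suc.hyps(2) fin by fastforce
    have iso: "{v, u} \<notin> edges F" for u using False v VR by auto
    have ee: "edges (remove_vertex F v) = edges F"
    proof -
      have "v \<notin> e" if e: "e \<in> edges F" for e
      proof
        assume "v \<in> e"
        then obtain z where "e = {v, z}" using simple_graph_edge_other[OF sg e] by blast
        then show False using that iso by blast
      qed
      then show ?thesis by (auto simp: remove_vertex_def)
    qed
    have "root_set (remove_vertex F v) (R - {v})"
      unfolding root_set_def
    proof (intro conjI ballI impI)
      fix r r' assume "r \<in> R - {v}" "r' \<in> R - {v}" "(r, r') \<in> (adjacency (remove_vertex F v))\<^sup>*"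
      then show "r = r'" using uniq adj_mono by blast
    qed (use VR in \<open>auto simp: remove_vertex_def\<close>)
    moreover have "rooted_cost F R n = rooted_cost (remove_vertex F v) (R - {v}) n +
        (card (\<phi> -` {v} \<union> \<phi> -` {}))\<^sup>2"
      using ee finR v VR by (simp add: rooted_cost_def n_def sum.remove)
    \<comment> \<open>An isolated vertex satisfies the leaf condition vacuously, so any vertex may
      stand for \<open>p\<close>.\<close>
    ultimately show ?thesis using step[OF v _ _ _, of undefined "R - {v}" "{}"] iso by blast
  qed
qed

lemma adjacency_rtrancl_sym: "(u, v) \<in> (adjacency F)\<^sup>* \<Longrightarrow> (v, u) \<in> (adjacency F)\<^sup>*"
  by (rule symD[OF sym_rtrancl]) (auto simp: sym_def adjacency_def insert_commute)

text \<open>Picking a vertex with the smallest \<open>n\<close> in each tree makes the root part of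
  \<open>rooted_cost\<close> equal to the second sum of \<open>approx_cost\<close>.\<close>

lemma root_set_min_exists:
  fixes n :: "'b \<Rightarrow> nat"
  assumes sg: "simple_graph F"
  obtains R where "root_set F R" "(\<Sum>r\<in>R. (n r)\<^sup>2) = (\<Sum>T\<in>components F. Min ((\<lambda>u. (n u)\<^sup>2) ` T))"
proof -
  define comp where "comp u = {v. (u, v) \<in> (adjacency F)\<^sup>*}" for u
  have comps: "components F = comp ` vertices F"
    by (simp add: components_def comp_def adjacency_def)
  have sub: "comp u \<subseteq> vertices F" if "u \<in> vertices F" for u
  proof
    fix v assume "v \<in> comp u"
    then have "(u, v) \<in> (adjacency F)\<^sup>*" by (simp add: comp_def)
    then show "v \<in> vertices F"
      using that by (cases rule: rtranclE) (auto simp: adjacency_def dest: simple_graph_edgeD[OF sg])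
  qed
  have same: "comp v = comp u" if "(u, v) \<in> (adjacency F)\<^sup>*" for u v
    using that adjacency_rtrancl_sym[OF that] by (auto simp: comp_def intro: rtrancl_trans)
  have "\<exists>r\<in>T. Min ((\<lambda>u. (n u)\<^sup>2) ` T) = (n r)\<^sup>2" if T: "T \<in> components F" for T
  proof -
    obtain u where u: "u \<in> vertices F" "T = comp u" using T comps by auto
    then have "u \<in> T" by (simp add: comp_def)
    moreover have "finite T" using u sub[OF u(1)] sg by (auto simp: simple_graph_def finite_subset)
    ultimately have "Min ((\<lambda>u. (n u)\<^sup>2) ` T) \<in> (\<lambda>u. (n u)\<^sup>2) ` T" by (intro Min_in) auto
    then show ?thesis by auto
  qed
  then obtain rep where rep: "\<And>T. T \<in> components F \<Longrightarrow> rep T \<in> T"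
    and rmin: "\<And>T. T \<in> components F \<Longrightarrow> Min ((\<lambda>u. (n u)\<^sup>2) ` T) = (n (rep T))\<^sup>2"
    by metis
  have comp_rep: "comp (rep T) = T" if T: "T \<in> components F" for T
  proof -
    obtain u where "T = comp u" using T comps by auto
    then show ?thesis using rep[OF T] same[of u "rep T"] by (simp add: comp_def)
  qed
  have "inj_on rep (components F)" by (rule inj_onI) (metis comp_rep)
  then have "(\<Sum>r\<in>rep ` components F. (n r)\<^sup>2) = (\<Sum>T\<in>components F. Min ((\<lambda>u. (n u)\<^sup>2) ` T))"
    by (simp add: sum.reindex rmin)
  moreover have "root_set F (rep ` components F)"
    unfolding root_set_def
  proof (intro conjI ballI impI)
    show "rep ` components F \<subseteq> vertices F"
    proof
      fix r assume "r \<in> rep ` components F"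
      then obtain T where T: "T \<in> components F" "r = rep T" by blast
      then obtain u where "u \<in> vertices F" "T = comp u" using comps by blast
      then show "r \<in> vertices F" using rep[OF T(1)] T(2) sub by blast
    qed
    fix u assume "u \<in> vertices F"
    then have "comp u \<in> components F" by (simp add: comps)
    with rep[OF this] show "\<exists>r\<in>rep ` components F. (u, r) \<in> (adjacency F)\<^sup>*"
      by (auto simp: comp_def)
  next
    fix r r' assume "r \<in> rep ` components F" "r' \<in> rep ` components F" "(r, r') \<in> (adjacency F)\<^sup>*"
    then show "r = r'" by (metis (no_types, lifting) comp_rep same imageE)
  qed
  ultimately show ?thesis using that by blast
qed

section \<open>From dependency graphs through forest approximations to a tail bound\<close>

definition dependency_weights ::
  "(('k::finite \<Rightarrow> 'a::finite) \<Rightarrow> real) \<Rightarrow> 'k ugraph \<Rightarrow> bool" where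
  "dependency_weights q G \<longleftrightarrow> (\<forall>I I'. I \<inter> I' = {} \<and> (\<forall>i\<in>I. \<forall>i'\<in>I'. {i, i'} \<notin> edges G) \<longrightarrow>
     indep_wrt q I I')"

lemma forest_complexity_attained:
  fixes G :: "'k ugraph"
  obtains \<phi> :: "'k \<Rightarrow> nat" and F where
    "forest_approximation G \<phi> F" "forest_complexity G = approx_cost G \<phi> F"
proof -
  have "forest_approximation G (\<lambda>_. 0 :: nat) \<lparr>vertices = {0}, edges = {}\<rparr>"
    by (auto simp: forest_approximation_def forest_def simple_graph_def is_cycle_def)
       (metis length_greater_0_conv list.size(3) not_numeral_le_zero)
  then have "\<exists>l (\<phi> :: 'k \<Rightarrow> nat) F. forest_approximation G \<phi> F \<and> l = approx_cost G \<phi> F" by blast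
  from LeastI_ex[OF this] show ?thesis using that unfolding forest_complexity_def by blast
qed

lemma mgf_bound_forest_complexity:
  fixes q :: "('k::finite \<Rightarrow> 'a::finite) \<Rightarrow> real"
  assumes q: "prob_weight q" and dep: "dependency_weights q G" and V: "vertices G = UNIV"
    and lip: "\<And>w w'. f w - f w' \<le> c * real (card {k. w k \<noteq> w' k})" and c: "0 \<le> c" and s: "0 < s"
  shows "wexp q (\<lambda>w. exp (s * (f w - wexp q f))) \<le> exp (s\<^sup>2 * c\<^sup>2 * real (forest_complexity G) / 8)"
proof -
  obtain \<phi> :: "'k \<Rightarrow> nat" and F where app: "forest_approximation G \<phi> F"
    and cost: "forest_complexity G = approx_cost G \<phi> F"
    by (rule forest_complexity_attained)
  have F: "forest F" and img: "\<phi> -` vertices F = UNIV"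
    and ed: "\<And>u v. {u, v} \<in> edges G \<Longrightarrow> \<phi> u = \<phi> v \<or> {\<phi> u, \<phi> v} \<in> edges F"
    using app V by (auto simp: forest_approximation_def)
  define n where "n = (\<lambda>u. card (\<phi> -` {u}))"
  have fiber: "fiber_card G \<phi> = n" by (simp add: fun_eq_iff fiber_card_def n_def V vimage_def)
  obtain R where R: "root_set F R"
    "(\<Sum>r\<in>R. (n r)\<^sup>2) = (\<Sum>T\<in>components F. Min ((\<lambda>u. (n u)\<^sup>2) ` T))"
    using root_set_min_exists F unfolding forest_def by metis
  \<comment> \<open>Separated vertex sets of \<open>F\<close> have disjoint fibres, and an edge of
    \<open>G\<close> between these fibres would be mapped to a common vertex or to an edge of
    \<open>F\<close>.\<close>
  have "block_dependency q \<phi> F"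
    unfolding block_dependency_def
  proof (intro allI impI, elim conjE)
    fix S S' :: "nat set"
    assume "S \<inter> S' = {}" "\<forall>u\<in>S. \<forall>u'\<in>S'. {u, u'} \<notin> edges F"
    then show "indep_wrt q (\<phi> -` S) (\<phi> -` S')"
      using ed by (intro dep[unfolded dependency_weights_def, rule_format]) fastforce
  qed
  moreover have "depends_on (\<phi> -` vertices F) f"
  proof -
    have "w = w'" if "\<forall>k\<in>\<phi> -` vertices F. w k = w' k" for w w' :: "'k \<Rightarrow> 'a"
      using that img by auto
    then show ?thesis unfolding depends_on_def by metis
  qed
  moreover have "rooted_cost F R n = forest_complexity G"
    using R(2) by (simp add: rooted_cost_def cost approx_cost_def fiber)
  ultimately have main: "wexp q (\<lambda>w. exp (s * f w)) \<le>
      exp (s * wexp q f + s\<^sup>2 * c\<^sup>2 * real (forest_complexity G) / 8)"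
    using forest_mgf_bound[OF F R(1) q _ _ lip c s] unfolding n_def by metis
  have "wexp q (\<lambda>w. exp (s * (f w - wexp q f))) = wexp q (\<lambda>w. exp (- (s * wexp q f)) * exp (s * f w))"
    by (intro wexp_cong) (simp add: right_diff_distrib flip: exp_add)
  also have "\<dots> = exp (- (s * wexp q f)) * wexp q (\<lambda>w. exp (s * f w))" by (rule wexp_cmult)
  also have "\<dots> \<le> exp (- (s * wexp q f)) *
      exp (s * wexp q f + s\<^sup>2 * c\<^sup>2 * real (forest_complexity G) / 8)"
    by (intro mult_left_mono main) simp
  finally show ?thesis by (simp flip: exp_add)
qed

lemma forest_complexity_tail:
  fixes q :: "('k::finite \<Rightarrow> 'a::finite) \<Rightarrow> real"
  assumes q: "prob_weight q" and dep: "dependency_weights q G" and V: "vertices G = UNIV"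
    and lip: "\<And>w w'. f w - f w' \<le> c * real (card {k. w k \<noteq> w' k})" and c: "0 \<le> c"
    and \<delta>: "0 < \<delta>" "\<delta> < 1"
  shows "1 - \<delta> \<le> sum q {w. f w \<le> wexp q f + c * sqrt (real (forest_complexity G) * ln (1 / \<delta>) / 2)}"
proof -
  define \<Lambda> where "\<Lambda> = real (forest_complexity G)"
  define l where "l = c\<^sup>2 * \<Lambda>"
  define t where "t = c * sqrt (\<Lambda> * ln (1 / \<delta>) / 2)"
  define bad where "bad = {w. wexp q f + t < f w}"
  have nonneg: "\<And>w. 0 \<le> q w" and sum1: "sum q UNIV = 1" using q by (auto simp: prob_weight_def)
  have mgf: "wexp q (\<lambda>w. exp (s * (f w - wexp q f))) \<le> exp (s\<^sup>2 * l / 8)" if "0 < s" for s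
    using mgf_bound_forest_complexity[OF q dep V lip c that] by (simp add: l_def \<Lambda>_def mult.assoc)
  have lnp: "0 < ln (1 / \<delta>)" using \<delta> by simp
  have l0: "0 \<le> l" by (simp add: l_def \<Lambda>_def)
  have t0: "0 \<le> t" unfolding t_def \<Lambda>_def using c lnp by (intro mult_nonneg_nonneg) auto
  have tsq: "t\<^sup>2 = l * ln (1 / \<delta>) / 2"
  proof -
    have "0 \<le> \<Lambda> * ln (1 / \<delta>) / 2" using lnp by (simp add: \<Lambda>_def)
    then show ?thesis by (simp add: t_def l_def power_mult_distrib)
  qed
  have "sum q bad \<le> \<delta>"
  \<comment> \<open>For \<open>l = 0\<close> the moment bound is 1 for every \<open>s\<close>, so no
    \<open>s\<close> is optimal; large \<open>s\<close> shows that \<open>bad\<close> carries no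
    weight.\<close>
  proof (cases "l = 0")
    case True
    have "q w = 0" if w: "w \<in> bad" for w
    proof (rule ccontr)
      assume "q w \<noteq> 0"
      then have qw: "0 < q w" using nonneg[of w] by simp
      define e where "e = f w - wexp q f"
      have e: "0 < e" using w t0 by (simp add: bad_def e_def)
      \<comment> \<open>Chosen so that \<open>q w * (1 + s * e)\<close> equals
        \<open>q w + 1\<close>, which exceeds the moment bound 1.\<close>
      define s where "s = 1 / (q w * e)"
      have s: "0 < s" using qw e by (simp add: s_def)
      have "q w * (1 + s * e) \<le> q w * exp (s * e)"
        using qw by (intro mult_left_mono exp_ge_add_one_self) auto
      also have "\<dots> \<le> wexp q (\<lambda>w. exp (s * (f w - wexp q f)))"
        unfolding wexp_def e_def
        by (rule member_le_sum[of w UNIV "\<lambda>w. q w * exp (s * (f w - wexp q f))", unfolded wexp_def])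
           (auto simp: nonneg)
      also have "\<dots> \<le> 1" using mgf[OF s] True by simp
      finally have "q w * (1 + s * e) \<le> 1" .
      moreover have "s * e = 1 / q w" using e by (simp add: s_def)
      then have "q w * (1 + s * e) = q w + 1" using qw by (simp add: distrib_left)
      ultimately show False using qw by simp
    qed
    then show ?thesis using \<delta> by simp
  next
    case False
    then have lpos: "0 < l" using l0 by simp
    then have tpos: "0 < t" using tsq lnp t0 by (cases "t = 0") auto
    \<comment> \<open>The minimiser of \<open>s\<^sup>2 * l / 8 - s * t\<close>; the minimum is
      \<open>- (2 * t\<^sup>2 / l)\<close>, which the choice of \<open>t\<close> makes equal to
      \<open>ln \<delta>\<close>.\<close>
    define s where "s = 4 * t / l"
    have s: "0 < s" using lpos tpos by (simp add: s_def)
    have "sum q bad * exp (s * t) = (\<Sum>w\<in>bad. q w * exp (s * t))" by (simp add: sum_distrib_right)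
    also have "\<dots> \<le> (\<Sum>w\<in>bad. q w * exp (s * (f w - wexp q f)))"
      using s nonneg by (intro sum_mono mult_left_mono) (auto simp: bad_def)
    also have "\<dots> \<le> wexp q (\<lambda>w. exp (s * (f w - wexp q f)))"
      unfolding wexp_def using nonneg by (intro sum_mono2) auto
    also have "\<dots> \<le> exp (s\<^sup>2 * l / 8)" by (rule mgf[OF s])
    finally have "sum q bad \<le> exp (s\<^sup>2 * l / 8) / exp (s * t)" by (simp add: pos_le_divide_eq)
    also have "\<dots> = exp (s\<^sup>2 * l / 8 - s * t)" by (simp add: exp_diff)
    also have "s\<^sup>2 * l / 8 - s * t = - (2 * t\<^sup>2 / l)"
      using lpos by (simp add: s_def power2_eq_square field_simps)
    also have "2 * t\<^sup>2 / l = ln (1 / \<delta>)" using lpos by (simp add: tsq)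
    also have "exp (- ln (1 / \<delta>)) = \<delta>" using \<delta> by (simp add: ln_div)
    finally show ?thesis .
  qed
  moreover have "sum q UNIV = sum q bad + sum q (- bad)"
    by (subst sum.union_disjoint[symmetric]) auto
  moreover have "- bad = {w. f w \<le> wexp q f + t}" by (auto simp: bad_def)
  ultimately show ?thesis using sum1 by (simp add: t_def \<Lambda>_def)
qed

section \<open>Sample means\<close>

text \<open>The second moment runs over ordered pairs, so an edge may count twice.\<close>

lemma card_adjacent_pairs_le:
  assumes "simple_graph G"
  shows "card {(k, l). {k, l} \<in> edges G} \<le> 2 * card (edges G)"
proof -
  have fin: "finite (edges G)" by (rule simple_graph_finite_edges[OF assms])
  have pair: "finite {(k, l). {k, l} = e} \<and> card {(k, l). {k, l} = e} \<le> 2" if e: "e \<in> edges G" for e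
  proof -
    have "\<exists>u\<in>vertices G. \<exists>v\<in>vertices G. u \<noteq> v \<and> e = {u, v}"
      using assms e by (simp add: simple_graph_def)
    then obtain u v where uv: "e = {u, v}" by blast
    have sub: "{(k, l). {k, l} = e} \<subseteq> set [(u, v), (v, u)]"
      unfolding uv doubleton_eq_iff by auto
    have two: "card (set [(u, v), (v, u)]) \<le> 2"
      using card_length[of "[(u, v), (v, u)]"] by (simp only: list.size)
    show ?thesis
    proof
      show "finite {(k, l). {k, l} = e}" by (rule finite_subset[OF sub]) simp
      show "card {(k, l). {k, l} = e} \<le> 2" by (rule order_trans[OF card_mono[OF _ sub] two]) simp
    qed
  qed
  have "{(k, l). {k, l} \<in> edges G} = (\<Union>e\<in>edges G. {(k, l). {k, l} = e})" by auto
  then have "card {(k, l). {k, l} \<in> edges G} \<le> (\<Sum>e\<in>edges G. card {(k, l). {k, l} = e})"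
    using card_UN_le[OF fin, of "\<lambda>e. {(k, l). {k, l} = e}"] by (simp only:)
  also have "\<dots> \<le> (\<Sum>e\<in>edges G. 2)" using pair by (intro sum_mono) blast
  finally show ?thesis by simp
qed

lemma wexp_coordinate:
  fixes q :: "('k::finite \<Rightarrow> 'a::finite) \<Rightarrow> real" and h :: "'a \<Rightarrow> real"
  assumes "\<And>t. wexp q (\<lambda>w. if w k = t then 1 else 0) = \<xi> t"
  shows "wexp q (\<lambda>w. h (w k)) = (\<Sum>t\<in>UNIV. \<xi> t * h t)"
proof -
  have "wexp q (\<lambda>w. h (w k)) = wexp q (\<lambda>w. \<Sum>t\<in>UNIV. h t * (if w k = t then 1 else 0))"
    by (intro wexp_cong) (simp add: if_distrib[of "\<lambda>x. _ * x"] cong: if_cong)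
  also have "\<dots> = (\<Sum>t\<in>UNIV. h t * \<xi> t)" by (simp add: wexp_sum wexp_cmult assms)
  finally show ?thesis by (simp add: mult.commute)
qed

text \<open>Expanding the square gives a sum over ordered pairs of indices. A diagonal term is a
  variance, at most the raw second moment, hence the factor \<open>R\<^sup>2\<close> instead of four
  times that. The inequality 2 x y \<le> x^2 + y^2 carries this to every pair, and distinct
  non-adjacent pairs vanish by centring.\<close>

lemma second_moment_bound:
  fixes q :: "('k::finite \<Rightarrow> 'a::finite) \<Rightarrow> real" and g :: "'a \<Rightarrow> 'v::real_inner"
  assumes q: "prob_weight q" and dep: "dependency_weights q G" and G: "simple_graph G"
    and marg: "\<And>k t. wexp q (\<lambda>w. if w k = t then 1 else 0) = \<xi> t"
    and R: "\<And>t. norm (g t) \<le> R"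
  defines "\<mu> \<equiv> (\<Sum>t\<in>UNIV. \<xi> t *\<^sub>R g t)"
  shows "wexp q (\<lambda>w. (norm (\<Sum>k\<in>UNIV. g (w k) - \<mu>))\<^sup>2) \<le>
    R\<^sup>2 * (real CARD('k) + 2 * real (card (edges G)))"
proof -
  define u where "u t = g t - \<mu>" for t
  define D where "D k l = wexp q (\<lambda>w. u (w k) \<bullet> u (w l))" for k l
  note coord = wexp_coordinate[of q _ \<xi>, OF marg]
  have \<xi>0: "0 \<le> \<xi> t" for t
    unfolding marg[of undefined, symmetric] by (rule wexp_nonneg[OF q]) simp
  have \<xi>1: "(\<Sum>t\<in>UNIV. \<xi> t) = 1"
    using coord[of "\<lambda>_. 1"] wexp_const[OF q] by simp
  have R0: "0 \<le> R" using R norm_ge_zero order_trans by blast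
  have mean: "(\<Sum>t\<in>UNIV. \<xi> t *\<^sub>R u t) = 0"
    by (simp add: u_def scaleR_diff_right sum_subtractf \<mu>_def flip: scaleR_left.sum)
       (simp add: \<xi>1)
  have diag: "D k k \<le> R\<^sup>2" for k
  proof -
    have "D k k = (\<Sum>t\<in>UNIV. \<xi> t * (u t \<bullet> u t))" unfolding D_def by (rule coord)
    also have "\<dots> = (\<Sum>t\<in>UNIV. \<xi> t * (u t \<bullet> g t)) - (\<Sum>t\<in>UNIV. \<xi> t *\<^sub>R u t) \<bullet> \<mu>"
      by (simp add: inner_sum_left inner_diff_right right_diff_distrib sum_subtractf u_def[of _]
          flip: sum_subtractf)
    also have "\<dots> = (\<Sum>t\<in>UNIV. \<xi> t * (g t \<bullet> g t)) - \<mu> \<bullet> \<mu>"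
      unfolding mean by (simp add: u_def inner_diff_left right_diff_distrib sum_subtractf)
        (simp add: \<mu>_def inner_sum_right)
    also have "\<dots> \<le> (\<Sum>t\<in>UNIV. \<xi> t * (g t \<bullet> g t))" by simp
    also have "\<dots> \<le> (\<Sum>t\<in>UNIV. \<xi> t * R\<^sup>2)"
      using R \<xi>0 by (intro sum_mono mult_left_mono) (auto simp: dot_square_norm intro!: power_mono)
    also have "\<dots> = R\<^sup>2" by (simp add: \<xi>1 flip: sum_distrib_right)
    finally show ?thesis .
  qed
  have any: "D k l \<le> R\<^sup>2" for k l
  proof -
    have "u (w k) \<bullet> u (w l) \<le> (1/2) * (u (w k) \<bullet> u (w k) + u (w l) \<bullet> u (w l))" for w
      using inner_ge_zero[of "u (w k) - u (w l)"]
      by (simp add: inner_diff_left inner_diff_right inner_commute)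
    then have "D k l \<le> wexp q (\<lambda>w. (1/2) * (u (w k) \<bullet> u (w k) + u (w l) \<bullet> u (w l)))"
      unfolding D_def by (intro wexp_mono[OF q])
    also have "\<dots> = (1/2) * (D k k + D l l)" unfolding D_def wexp_cmult wexp_add ..
    finally show ?thesis using diag[of k] diag[of l] by simp
  qed
  have zero: "D k l = 0" if "k \<noteq> l" "{k, l} \<notin> edges G" for k l
  proof -
    have ind: "indep_wrt q {k} {l}"
      using that by (intro dep[unfolded dependency_weights_def, rule_format]) auto
    \<comment> \<open>Splitting by the value of \<open>w k\<close> yields products of a function of
      \<open>w k\<close> and a function of \<open>w l\<close>, the shape that
      \<open>indep_wrt\<close> factorises.\<close>
    have "D k l = wexp q (\<lambda>w. \<Sum>s\<in>UNIV. (if w k = s then 1 else 0) * (u s \<bullet> u (w l)))"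
      unfolding D_def by (intro wexp_cong) (simp add: if_distrib[of "\<lambda>x. x * _"] cong: if_cong)
    also have "\<dots> = (\<Sum>s\<in>UNIV. wexp q (\<lambda>w. (if w k = s then 1 else 0) * (u s \<bullet> u (w l))))"
      by (rule wexp_sum)
    also have "\<dots> = (\<Sum>s\<in>UNIV. wexp q (\<lambda>w. if w k = s then 1 else 0) * wexp q (\<lambda>w. u s \<bullet> u (w l)))"
      by (intro sum.cong refl ind[unfolded indep_wrt_def, rule_format]) (auto simp: depends_on_def)
    also have "\<dots> = 0"
    proof (intro sum.neutral ballI)
      fix s
      have "wexp q (\<lambda>w. u s \<bullet> u (w l)) = u s \<bullet> (\<Sum>t\<in>UNIV. \<xi> t *\<^sub>R u t)"
        using coord[of "\<lambda>t. u s \<bullet> u t" l] by (simp add: inner_sum_right)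
      then show "wexp q (\<lambda>w. if w k = s then 1 else 0) * wexp q (\<lambda>w. u s \<bullet> u (w l)) = 0"
        by (simp add: mean)
    qed
    finally show ?thesis .
  qed
  let ?A = "{(k, l). {k, l} \<in> edges G}"
  have "wexp q (\<lambda>w. (norm (\<Sum>k\<in>UNIV. g (w k) - \<mu>))\<^sup>2) =
      wexp q (\<lambda>w. \<Sum>k\<in>UNIV. \<Sum>l\<in>UNIV. u (w k) \<bullet> u (w l))"
    by (intro wexp_cong)
      (simp only: power2_norm_eq_inner inner_sum_left, simp only: inner_sum_right u_def)
  also have "\<dots> = (\<Sum>k\<in>UNIV. \<Sum>l\<in>UNIV. D k l)" by (simp only: wexp_sum D_def)
  also have "\<dots> = (\<Sum>(k, l)\<in>UNIV. D k l)" by (simp only: sum.cartesian_product UNIV_Times_UNIV)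
  also have "\<dots> = (\<Sum>(k, l)\<in>range (\<lambda>k. (k, k)) \<union> ?A. D k l)"
    by (intro sum.mono_neutral_right) (auto intro: zero)
  also have "\<dots> \<le> (\<Sum>(k, l)\<in>range (\<lambda>k. (k, k)) \<union> ?A. R\<^sup>2)"
    by (intro sum_mono) (auto intro: any)
  also have "\<dots> = R\<^sup>2 * real (card (range (\<lambda>k :: 'k. (k, k)) \<union> ?A))" by simp
  also have "\<dots> \<le> R\<^sup>2 * real (CARD('k) + 2 * card (edges G))"
  proof (intro mult_left_mono of_nat_mono)
    show "card (range (\<lambda>k :: 'k. (k, k)) \<union> ?A) \<le> CARD('k) + 2 * card (edges G)"
    using card_Un_le[of "range (\<lambda>k :: 'k. (k, k))" ?A] card_adjacent_pairs_le[OF G]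
      card_image_le[of UNIV "\<lambda>k :: 'k. (k, k)"] by simp
  qed simp
  finally show ?thesis by simp
qed

lemma sample_mean_concentration:
  fixes q :: "('k::finite \<Rightarrow> 'a::finite) \<Rightarrow> real" and g :: "'a \<Rightarrow> 'v::real_inner"
  assumes q: "prob_weight q" and dep: "dependency_weights q G" and G: "simple_graph G"
    and V: "vertices G = UNIV"
    and marg: "\<And>k t. wexp q (\<lambda>w. if w k = t then 1 else 0) = \<xi> t"
    and R: "\<And>t. norm (g t) \<le> R" and \<delta>: "0 < \<delta>" "\<delta> < 1"
  shows "1 - \<delta> \<le> sum q {w.
    norm ((1 / real CARD('k)) *\<^sub>R (\<Sum>k\<in>UNIV. g (w k)) - (\<Sum>t\<in>UNIV. \<xi> t *\<^sub>R g t)) \<le>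
    R * (sqrt ((real CARD('k) + 2 * real (card (edges G))) / (real CARD('k))\<^sup>2) +
         sqrt (2 * real (forest_complexity G) * ln (1 / \<delta>) / (real CARD('k))\<^sup>2))}"
proof -
  define K where "K = real CARD('k)"
  define E where "E = real (card (edges G))"
  define \<mu> where "\<mu> = (\<Sum>t\<in>UNIV. \<xi> t *\<^sub>R g t)"
  define f where "f w = norm ((1 / K) *\<^sub>R (\<Sum>k\<in>UNIV. g (w k)) - \<mu>)" for w :: "'k \<Rightarrow> 'a"
  \<comment> \<open>Changing one index replaces one of \<open>K\<close> vectors of norm at most
    \<open>R\<close>, so the mean moves by at most \<open>2 * R / K\<close>.\<close>
  define c where "c = 2 * R / K"
  have K: "0 < K" by (simp add: K_def)
  have R0: "0 \<le> R" using R norm_ge_zero order_trans by blast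
  have c0: "0 \<le> c" using R0 K by (simp add: c_def)
  have lip: "f w - f w' \<le> c * real (card {k. w k \<noteq> w' k})" for w w'
  proof -
    have "f w - f w' \<le> norm (((1 / K) *\<^sub>R (\<Sum>k\<in>UNIV. g (w k)) - \<mu>) - ((1 / K) *\<^sub>R (\<Sum>k\<in>UNIV. g (w' k)) - \<mu>))"
      unfolding f_def by (rule norm_triangle_ineq2)
    also have "\<dots> = norm ((1 / K) *\<^sub>R (\<Sum>k\<in>UNIV. g (w k) - g (w' k)))"
      by (simp add: sum_subtractf scaleR_diff_right)
    also have "\<dots> = (1 / K) * norm (\<Sum>k\<in>UNIV. g (w k) - g (w' k))" using K by simp
    also have "(\<Sum>k\<in>UNIV. g (w k) - g (w' k)) = (\<Sum>k | w k \<noteq> w' k. g (w k) - g (w' k))"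
      by (intro sum.mono_neutral_right) auto
    also have "norm \<dots> \<le> (\<Sum>k | w k \<noteq> w' k. 2 * R)"
    proof (intro sum_norm_le)
      fix k
      show "norm (g (w k) - g (w' k)) \<le> 2 * R"
        using norm_triangle_ineq4[of "g (w k)" "g (w' k)"] R[of "w k"] R[of "w' k"] by simp
    qed
    finally show ?thesis using K by (simp add: c_def mult_ac divide_right_mono)
  qed
  have Ef: "wexp q f \<le> R * sqrt ((K + 2 * E) / K\<^sup>2)"
  proof -
    have sq: "(f w)\<^sup>2 = (1 / K\<^sup>2) * (norm (\<Sum>k\<in>UNIV. g (w k) - \<mu>))\<^sup>2" for w
    proof -
      have "(1 / K) *\<^sub>R (\<Sum>k\<in>UNIV. g (w k)) - \<mu> = (1 / K) *\<^sub>R (\<Sum>k\<in>UNIV. g (w k) - \<mu>)"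
        using K by (simp add: sum_subtractf scaleR_diff_right K_def sum_constant_scaleR)
      then show ?thesis using K by (simp add: f_def power_divide)
    qed
    have "(wexp q f)\<^sup>2 \<le> wexp q (\<lambda>w. (f w)\<^sup>2)" by (rule wexp_square_le[OF q])
    also have "\<dots> = (1 / K\<^sup>2) * wexp q (\<lambda>w. (norm (\<Sum>k\<in>UNIV. g (w k) - \<mu>))\<^sup>2)"
      unfolding sq by (rule wexp_cmult)
    also have "\<dots> \<le> (1 / K\<^sup>2) * (R\<^sup>2 * (K + 2 * E))"
      using second_moment_bound[of q G \<xi> g R, OF q dep G marg R]
      unfolding K_def E_def \<mu>_def by (intro mult_left_mono) auto
    also have "\<dots> = R\<^sup>2 * ((K + 2 * E) / K\<^sup>2)" by simp
    finally have "wexp q f \<le> sqrt (R\<^sup>2 * ((K + 2 * E) / K\<^sup>2))" by (rule real_le_rsqrt)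
    also have "\<dots> = R * sqrt ((K + 2 * E) / K\<^sup>2)"
      using R0 by (simp only: real_sqrt_mult real_sqrt_abs abs_of_nonneg)
    finally show ?thesis .
  qed
  have dev: "c * sqrt (\<Lambda> * l / 2) = R * sqrt (2 * \<Lambda> * l / K\<^sup>2)" for \<Lambda> l :: real
  proof -
    have "2 * \<Lambda> * l / K\<^sup>2 = (2 / K)\<^sup>2 * (\<Lambda> * l / 2)" using K by (simp add: power2_eq_square field_simps)
    then have "sqrt (2 * \<Lambda> * l / K\<^sup>2) = (2 / K) * sqrt (\<Lambda> * l / 2)"
      using K by (simp only: real_sqrt_mult real_sqrt_abs) simp
    then show ?thesis by (simp add: c_def)
  qed
  have "1 - \<delta> \<le> sum q {w. f w \<le> wexp q f + c * sqrt (real (forest_complexity G) * ln (1 / \<delta>) / 2)}"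
    by (rule forest_complexity_tail[OF q dep V lip c0 \<delta>])
  also have "\<dots> \<le> sum q {w. f w \<le> R * (sqrt ((K + 2 * E) / K\<^sup>2) +
      sqrt (2 * real (forest_complexity G) * ln (1 / \<delta>) / K\<^sup>2))}"
    using q Ef unfolding dev by (intro sum_mono2) (auto simp: prob_weight_def distrib_left)
  finally show ?thesis by (simp add: f_def K_def E_def \<mu>_def)
qed

section \<open>Transfer from random indices to their joint law on a finite outcome space\<close>

definition law :: "'w measure \<Rightarrow> ('k::finite \<Rightarrow> 'w \<Rightarrow> 'a::finite) \<Rightarrow> ('k \<Rightarrow> 'a) \<Rightarrow> real" where
  "law M J w = measure M {\<omega> \<in> space M. (\<lambda>k. J k \<omega>) = w}"

context
  fixes M :: "'w measure" and J :: "'k::finite \<Rightarrow> 'w \<Rightarrow> 'a::finite"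
  assumes M: "prob_space M" and J: "\<And>k. J k \<in> measurable M (count_space UNIV)"
begin

interpretation prob_space M by (rule M)

lemma outcome_measurable: "(\<lambda>\<omega> k. J k \<omega>) \<in> measurable M (count_space UNIV)"
proof -
  note J[measurable]
  have "(\<lambda>\<omega> k. J k \<omega>) -` {w} \<inter> space M = {\<omega> \<in> space M. \<forall>k. J k \<omega> = w k}" for w
    by (auto simp: fun_eq_iff)
  moreover have "{\<omega> \<in> space M. \<forall>k. J k \<omega> = w k} \<in> sets M" for w by measurable
  ultimately show ?thesis by (simp add: measurable_count_space_eq2)
qed

lemma measure_outcome: "measure M {\<omega> \<in> space M. P (\<lambda>k. J k \<omega>)} = sum (law M J) {w. P w}"
proof -
  have meas: "{\<omega> \<in> space M. (\<lambda>k. J k \<omega>) = w} \<in> sets M" for w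
    using measurable_sets[OF outcome_measurable, of "{w}"] by (simp add: vimage_def Int_def conj_commute)
  have "measure M (\<Union>w\<in>{w. P w}. {\<omega> \<in> space M. (\<lambda>k. J k \<omega>) = w}) =
      (\<Sum>w\<in>{w. P w}. measure M {\<omega> \<in> space M. (\<lambda>k. J k \<omega>) = w})"
    by (rule finite_measure_finite_Union) (auto simp: disjoint_family_on_def meas)
  moreover have "(\<Union>w\<in>{w. P w}. {\<omega> \<in> space M. (\<lambda>k. J k \<omega>) = w}) = {\<omega> \<in> space M. P (\<lambda>k. J k \<omega>)}"
    by auto
  ultimately show ?thesis by (simp add: law_def)
qed

lemma prob_weight_law: "prob_weight (law M J)"
  using measure_outcome[of "\<lambda>_. True"] by (simp add: prob_weight_def prob_space) (simp add: law_def)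

lemma expectation_outcome: "(\<integral>\<omega>. g (\<lambda>k. J k \<omega>) \<partial>M) = wexp (law M J) g"
proof -
  have meas: "{\<omega> \<in> space M. (\<lambda>k. J k \<omega>) = w} \<in> sets M" for w
    using measurable_sets[OF outcome_measurable, of "{w}"] by (simp add: vimage_def Int_def conj_commute)
  have "(\<integral>\<omega>. g (\<lambda>k. J k \<omega>) \<partial>M) =
      (\<integral>\<omega>. (\<Sum>w\<in>UNIV. g w * indicator {\<omega> \<in> space M. (\<lambda>k. J k \<omega>) = w} \<omega>) \<partial>M)"
  proof (intro Bochner_Integration.integral_cong refl)
    fix \<omega> assume "\<omega> \<in> space M"
    then have "(\<Sum>w\<in>UNIV. g w * indicator {\<omega> \<in> space M. (\<lambda>k. J k \<omega>) = w} \<omega>) =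
        (\<Sum>w\<in>UNIV. if w = (\<lambda>k. J k \<omega>) then g w else 0)"
      by (intro sum.cong) (auto simp: indicator_def)
    then show "g (\<lambda>k. J k \<omega>) = (\<Sum>w\<in>UNIV. g w * indicator {\<omega> \<in> space M. (\<lambda>k. J k \<omega>) = w} \<omega>)"
      by simp
  qed
  also have "\<dots> = (\<Sum>w\<in>UNIV. g w * measure M {\<omega> \<in> space M. (\<lambda>k. J k \<omega>) = w})"
    by (subst Bochner_Integration.integral_sum) (auto simp: meas less_top[symmetric])
  finally show ?thesis by (simp add: wexp_def law_def mult.commute)
qed

text \<open>The tuples in \<open>dependency_graph\<close> are restricted, hence
  \<open>undefined\<close> outside \<open>I\<close>, which a function with
  \<open>depends_on I\<close> cannot see. On a finite product of discrete spaces every function is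
  measurable, so independence passes from the tuples to \<open>g\<close> and
  \<open>h\<close>.\<close>

lemma dependency_weights_law:
  assumes "dependency_graph M (count_space UNIV) J G"
  shows "dependency_weights (law M J) G"
  unfolding dependency_weights_def indep_wrt_def
proof (intro allI impI)
  fix I I' and g h :: "('k \<Rightarrow> 'a) \<Rightarrow> real"
  assume II: "I \<inter> I' = {} \<and> (\<forall>i\<in>I. \<forall>i'\<in>I'. {i, i'} \<notin> edges G)"
    and g: "depends_on I g" and h: "depends_on I' h"
  have ind: "indep_var (Pi\<^sub>M I (\<lambda>_. count_space UNIV)) (\<lambda>\<omega>. \<lambda>i\<in>I. J i \<omega>)
      (Pi\<^sub>M I' (\<lambda>_. count_space UNIV)) (\<lambda>\<omega>. \<lambda>i\<in>I'. J i \<omega>)"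
    using assms II unfolding dependency_graph_def by blast
  have meas: "u \<in> measurable (Pi\<^sub>M S (\<lambda>_. count_space UNIV)) borel"
    for S :: "'k set" and u :: "('k \<Rightarrow> 'a) \<Rightarrow> real"
    by (subst count_space_PiM_finite) auto
  have "indep_var borel (g \<circ> (\<lambda>\<omega>. \<lambda>i\<in>I. J i \<omega>)) borel (h \<circ> (\<lambda>\<omega>. \<lambda>i\<in>I'. J i \<omega>))"
    by (rule indep_var_compose[OF ind meas meas])
  moreover have "g \<circ> (\<lambda>\<omega>. \<lambda>i\<in>I. J i \<omega>) = (\<lambda>\<omega>. g (\<lambda>k. J k \<omega>))"
    by (rule ext, unfold comp_def, rule g[unfolded depends_on_def, rule_format]) simp
  moreover have "h \<circ> (\<lambda>\<omega>. \<lambda>i\<in>I'. J i \<omega>) = (\<lambda>\<omega>. h (\<lambda>k. J k \<omega>))"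
    by (rule ext, unfold comp_def, rule h[unfolded depends_on_def, rule_format]) simp
  ultimately have ind': "indep_var borel (\<lambda>\<omega>. g (\<lambda>k. J k \<omega>)) borel (\<lambda>\<omega>. h (\<lambda>k. J k \<omega>))"
    by simp
  have int: "integrable M (\<lambda>\<omega>. u (\<lambda>k. J k \<omega>))" for u :: "('k \<Rightarrow> 'a) \<Rightarrow> real"
  proof (rule integrable_const_bound[where B = "Max (range (\<lambda>w. norm (u w)))"])
    show "(\<lambda>\<omega>. u (\<lambda>k. J k \<omega>)) \<in> borel_measurable M"
      by (rule measurable_compose[OF outcome_measurable]) simp
  qed auto
  show "wexp (law M J) (\<lambda>w. g w * h w) = wexp (law M J) g * wexp (law M J) h"
    using indep_var_lebesgue_integral[OF ind' int int] unfolding expectation_outcome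
    using expectation_outcome[of "\<lambda>w. g w * h w"] by simp
qed

lemma marginal_law: "wexp (law M J) (\<lambda>w. if w k = t then 1 else 0) = measure M {\<omega> \<in> space M. J k \<omega> = t}"
  unfolding measure_outcome[of "\<lambda>w. w k = t"]
  by (simp add: wexp_def if_distrib[of "\<lambda>x. _ * x"] sum.If_cases cong: if_cong)

end

section \<open>Dual basic solutions\<close>

lemma matrix_vector_mult_columns: "(A :: real^'k^'m) *v x = (\<Sum>k\<in>UNIV. x $ k *\<^sub>R column k A)"
  by (simp add: vec_eq_iff matrix_vector_mult_def column_def mult.commute)

text \<open>Farkas: if \<open>L\<close> lies below the optimal value, then \<open>(b, L)\<close> is outside the closed cone
  spanned by \<open>(A\<^sub>k, c\<^sub>k)\<close> and \<open>(0, 1)\<close>.\<close>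

lemma lp_dual_feasible_exists:
  fixes A :: "real^'k^'m" and c :: "real^'k" and b :: "real^'m"
  assumes feas: "std_feasible A b \<noteq> {}" and low: "\<And>x. x \<in> std_feasible A b \<Longrightarrow> L < c \<bullet> x"
  shows "\<exists>p. (\<forall>k. p \<bullet> column k A \<le> c $ k) \<and> L \<le> p \<bullet> b"
proof -
  define S where "S = insert (0, 1) (range (\<lambda>k. (column k A, c $ k)))"
  let ?K = "convex_cone hull S"
  \<comment> \<open>An explicit convex cone containing the generators, with \<open>s\<close> the
    multiple of (0, 1). A representation of (b, L) in it would be a feasible point of value at most
    \<open>L\<close>.\<close>
  define T where "T = {(A *v x, c \<bullet> x + s) | x s. (\<forall>k. 0 \<le> x $ k) \<and> 0 \<le> s}"
  have TI: "(A *v x, c \<bullet> x + s) \<in> T" if "\<forall>k. 0 \<le> x $ k" "0 \<le> s" for x s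
    using that by (auto simp: T_def)
  have TE: "\<exists>x s. y = (A *v x, c \<bullet> x + s) \<and> (\<forall>k. 0 \<le> x $ k) \<and> 0 \<le> s" if "y \<in> T" for y
    using that by (simp add: T_def)
  have ccT: "convex_cone T"
    unfolding convex_cone_iff
  proof (intro conjI ballI allI impI)
    show "0 \<in> T" using TI[of 0 0] by (simp add: zero_prod_def)
  next
    fix y z assume "y \<in> T" "z \<in> T"
    then obtain x s x' s' where "y = (A *v x, c \<bullet> x + s)" "\<forall>k. 0 \<le> x $ k" "0 \<le> s"
      and "z = (A *v x', c \<bullet> x' + s')" "\<forall>k. 0 \<le> x' $ k" "0 \<le> s'"
      by (metis TE)
    then show "y + z \<in> T" using TI[of "x + x'" "s + s'"]
      by (simp add: matrix_vector_right_distrib inner_add_right add_ac)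
  next
    fix y and t :: real assume "y \<in> T" "0 \<le> t"
    moreover from this obtain x s where "y = (A *v x, c \<bullet> x + s)" "\<forall>k. 0 \<le> x $ k" "0 \<le> s"
      by (metis TE)
    ultimately show "t *\<^sub>R y \<in> T" using TI[of "t *\<^sub>R x" "t * s"]
      by (simp add: matrix_vector_mult_scaleR distrib_left)
  qed
  have "S \<subseteq> T"
  proof
    fix y assume "y \<in> S"
    then consider "y = (0, 1)" | k where "y = (column k A, c $ k)" unfolding S_def by auto
    then show "y \<in> T"
    proof cases
      case 1
      then show ?thesis using TI[of 0 1] by simp
    next
      case 2
      have "\<forall>j. 0 \<le> axis k (1::real) $ j" by (simp add: axis_def)
      then show ?thesis using TI[of "axis k 1" 0] 2
        by (simp add: matrix_vector_mul_component matrix_vector_mult_basis inner_axis)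
    qed
  qed
  then have KT: "?K \<subseteq> T" by (rule hull_minimal[of S T convex_cone, OF _ ccT])
  have notin: "(b, L) \<notin> ?K"
  proof
    assume "(b, L) \<in> ?K"
    then obtain x s where x: "b = A *v x" "L = c \<bullet> x + s" "\<forall>k. 0 \<le> x $ k" "0 \<le> s"
      using TE KT by blast
    then show False using low[of x] by (simp add: std_feasible_def)
  qed
  have "convex ?K" "closed ?K"
    using convex_cone_convex_cone_hull[of S] closed_convex_cone_hull[of S]
    by (auto simp: convex_cone_def S_def)
  then obtain a \<beta> where a: "a \<bullet> (b, L) < \<beta>" and aK: "\<forall>x\<in>?K. \<beta> < a \<bullet> x"
    using separating_hyperplane_closed_point[OF _ _ notin] by blast
  obtain u r where ur: "a = (u, r)" by (cases a)
  have "\<beta> < 0" using aK convex_cone_hull_contains_0[of S] by fastforce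
  with a have ub: "u \<bullet> b + r * L < 0" by (simp add: ur)
  have nonneg: "0 \<le> a \<bullet> y" if y: "y \<in> S" for y
  proof (rule ccontr)
    assume neg: "\<not> 0 \<le> a \<bullet> y"
    \<comment> \<open>Scaling \<open>y\<close> by this nonnegative factor lands exactly on the
      separating hyperplane, which the cone does not meet.\<close>
    have "(\<beta> / (a \<bullet> y)) *\<^sub>R y \<in> ?K"
      using neg \<open>\<beta> < 0\<close> y by (intro convex_cone_hull_mul hull_inc) (auto simp: divide_nonpos_nonpos)
    then have "\<beta> < a \<bullet> ((\<beta> / (a \<bullet> y)) *\<^sub>R y)" using aK by blast
    then show False using neg by simp
  qed
  have r0: "0 \<le> r" using nonneg[of "(0, 1)"] by (simp add: ur S_def)
  have uk: "0 \<le> u \<bullet> column k A + r * c $ k" for k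
    using nonneg[of "(column k A, c $ k)"] by (simp add: ur S_def)
  show ?thesis
  \<comment> \<open>A vertical hyperplane is impossible: at a feasible point it would give
    \<open>u \<bullet> b\<close> a nonnegative value. Otherwise division by \<open>- r\<close> turns
    \<open>u\<close> into the dual point.\<close>
  proof (cases "r = 0")
    case True
    obtain x where x: "A *v x = b" "\<forall>k. 0 \<le> x $ k" using feas by (auto simp: std_feasible_def)
    have "u \<bullet> b = (\<Sum>k\<in>UNIV. x $ k * (u \<bullet> column k A))"
      unfolding x(1)[symmetric] matrix_vector_mult_columns by (simp add: inner_sum_right)
    also have "0 \<le> \<dots>" using uk x(2) True by (intro sum_nonneg) auto
    finally show ?thesis using ub True by simp
  next
    case False
    then have r: "0 < r" using r0 by simp
    have "(- (1 / r) *\<^sub>R u) \<bullet> column k A \<le> c $ k" for k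
      using uk[of k] r by (simp add: field_simps)
    moreover have "L \<le> (- (1 / r) *\<^sub>R u) \<bullet> b" using ub r by (simp add: field_simps)
    ultimately show ?thesis by blast
  qed
qed

text \<open>Among the dual solutions of value at least \<open>L\<close>, one with the most tight constraints is basic:
  otherwise move along a direction orthogonal to all tight columns until another one becomes tight.\<close>

lemma lp_dual_vertex_exists:
  fixes A :: "real^'k^'m" and c :: "real^'k" and b :: "real^'m"
  assumes feas: "std_feasible A b \<noteq> {}" and low: "\<And>x. x \<in> std_feasible A b \<Longrightarrow> L < c \<bullet> x"
    and rank: "rank A = CARD('m)"
  shows "\<exists>p. (\<forall>k. p \<bullet> column k A \<le> c $ k) \<and> L \<le> p \<bullet> b \<and>
    span {column k A | k. p \<bullet> column k A = c $ k} = UNIV"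
proof -
  define good where "good p \<longleftrightarrow> (\<forall>k. p \<bullet> column k A \<le> c $ k) \<and> L \<le> p \<bullet> b" for p
  define tight where "tight p = {k. p \<bullet> column k A = c $ k}" for p
  obtain p0 where "good p0" using lp_dual_feasible_exists[OF feas low] by (auto simp: good_def)
  moreover have "\<forall>p. good p \<longrightarrow> card (tight p) < Suc CARD('k)"
    by (simp add: less_Suc_eq_le card_mono)
  ultimately obtain p where p: "good p" and mx: "\<And>p'. good p' \<Longrightarrow> card (tight p') \<le> card (tight p)"
    using ex_has_greatest_nat[of good p0 "\<lambda>p. card (tight p)"] by blast
  obtain x where x: "A *v x = b" "\<forall>k. 0 \<le> x $ k" using feas by (auto simp: std_feasible_def)
  have "span {column k A | k. k \<in> tight p} = UNIV"
  proof (rule ccontr)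
    assume "span {column k A | k. k \<in> tight p} \<noteq> UNIV"
    then obtain d0 where d0: "d0 \<noteq> 0" "\<And>k. k \<in> tight p \<Longrightarrow> d0 \<bullet> column k A = 0"
      using span_not_UNIV_orthogonal[of "{column k A | k. k \<in> tight p}"] span_base
      by (metis (mono_tags, lifting) mem_Collect_eq)
    have nz: "\<exists>k. d0 \<bullet> column k A \<noteq> 0"
    proof (rule ccontr)
      assume "\<nexists>k. d0 \<bullet> column k A \<noteq> 0"
      then have "d0 \<bullet> (A *v y) = 0" for y
        by (simp add: matrix_vector_mult_columns inner_sum_right)
      moreover obtain y where "d0 = A *v y" using rank full_rank_surjective by (metis surjD)
      ultimately show False using d0(1) by (metis inner_eq_zero_iff)
    qed
    have db: "d \<bullet> b = (\<Sum>k\<in>UNIV. x $ k * (d \<bullet> column k A))" for d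
      unfolding x(1)[symmetric] matrix_vector_mult_columns by (simp add: inner_sum_right)
    \<comment> \<open>The sign of \<open>d0\<close> is chosen so that the objective does not drop.
      If it grows, some column has a positive product because \<open>b\<close> is a nonnegative
      combination of columns; if it is constant, a column with nonzero product decides the
      sign.\<close>
    have "\<exists>d. 0 \<le> d \<bullet> b \<and> (\<exists>k. 0 < d \<bullet> column k A) \<and> (\<forall>k\<in>tight p. d \<bullet> column k A = 0)"
    proof -
      have pos: "\<exists>k. 0 < d \<bullet> column k A" if "0 < d \<bullet> b" for d
      proof (rule ccontr)
        assume "\<nexists>k. 0 < d \<bullet> column k A"
        then have "d \<bullet> b \<le> 0" unfolding db using x(2)
          by (intro sum_nonpos) (simp add: mult_nonneg_nonpos not_less)
        then show False using that by simp
      qed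
      obtain k where k: "d0 \<bullet> column k A \<noteq> 0" using nz by blast
      consider "0 < d0 \<bullet> b" | "0 < (- d0) \<bullet> b" | "d0 \<bullet> b = 0" by fastforce
      then show ?thesis
      proof cases
        case 1
        then show ?thesis using pos d0(2) by (intro exI[of _ d0]) auto
      next
        case 2
        then show ?thesis using pos[OF 2] d0(2) by (intro exI[of _ "- d0"]) auto
      next
        case 3
        show ?thesis
        proof (cases "0 < d0 \<bullet> column k A")
          case True
          then show ?thesis using 3 d0(2) by (intro exI[of _ d0]) auto
        next
          case False
          then have "0 < (- d0) \<bullet> column k A" using k by simp
          then show ?thesis using 3 d0(2) by (intro exI[of _ "- d0"]) auto
        qed
      qed
    qed
    then obtain d where d: "0 \<le> d \<bullet> b" "\<exists>k. 0 < d \<bullet> column k A" "\<And>k. k \<in> tight p \<Longrightarrow> d \<bullet> column k A = 0"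
      by blast
    define Q where "Q = {k. 0 < d \<bullet> column k A}"
    \<comment> \<open>Ratio test: the smallest ratio is the longest step along \<open>d\<close> that
      stays dual feasible, and its column becomes tight.\<close>
    define ratio where "ratio k = (c $ k - p \<bullet> column k A) / (d \<bullet> column k A)" for k
    have "finite Q" "Q \<noteq> {}" using d(2) by (auto simp: Q_def)
    then obtain k0 where k0: "k0 \<in> Q" "\<And>k. k \<in> Q \<Longrightarrow> ratio k0 \<le> ratio k"
      using ex_is_arg_min_if_finite[of Q ratio] by (auto simp: is_arg_min_linorder)
    define p' where "p' = p + ratio k0 *\<^sub>R d"
    have pk: "p \<bullet> column k A \<le> c $ k" for k using p by (simp add: good_def)
    have t0: "0 \<le> ratio k0" using k0(1) pk by (simp add: ratio_def Q_def)
    have p'k: "p' \<bullet> column k A = p \<bullet> column k A + ratio k0 * (d \<bullet> column k A)" for k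
      by (simp add: p'_def inner_add_left)
    have "p' \<bullet> column k A \<le> c $ k" for k
    proof (cases "k \<in> Q")
      case True
      then show ?thesis using k0(2)[OF True] by (simp add: p'k ratio_def[of k] Q_def field_simps)
    next
      case False
      then have "ratio k0 * (d \<bullet> column k A) \<le> 0" using t0 by (simp add: Q_def mult_nonneg_nonpos)
      then show ?thesis using pk[of k] by (simp add: p'k)
    qed
    moreover have "p \<bullet> b \<le> p' \<bullet> b" using t0 d(1) by (simp add: p'_def inner_add_left)
    ultimately have "good p'" using p by (auto simp: good_def)
    moreover have "tight p \<subset> tight p'"
    proof
      show "tight p \<subseteq> tight p'" using d(3) by (auto simp: tight_def p'k)
      have "k0 \<in> tight p'" using k0(1) by (simp add: tight_def p'k ratio_def Q_def)
      moreover have "k0 \<notin> tight p" using d(3) k0(1) by (force simp: Q_def)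
      ultimately show "tight p \<noteq> tight p'" by blast
    qed
    then have "card (tight p) < card (tight p')" by (intro psubset_card_mono) auto
    ultimately show False using mx by fastforce
  qed
  then show ?thesis using p by (auto simp: good_def tight_def)
qed

text \<open>Independent columns chosen among the tight ones form a basis matrix, and tightness says
  that \<open>p\<close> times this matrix is the basic part of \<open>c\<close>; inverting the
  matrix recovers \<open>p\<close>.\<close>

lemma spanning_tight_columns_basis:
  fixes A :: "real^'n^'m" and c :: "real^'n" and p :: "real^'m"
  assumes span: "span {column t A | t. t \<in> S} = UNIV"
    and tight: "\<And>t. t \<in> S \<Longrightarrow> p \<bullet> column t A = c $ t"
  shows "\<exists>B. is_basis A B \<and> dual_basic_solution A c B = p"
proof -
  let ?C = "{column t A | t. t \<in> S}"
  obtain D where D: "D \<subseteq> ?C" "independent D" "?C \<subseteq> span D" "card D = dim ?C"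
    using basis_exists by blast
  have spanD: "span D = UNIV" using span D(3) span_minimal[OF D(3) subspace_span] by auto
  have cardD: "card D = CARD('m)"
    using D(4) dim_span[of ?C] by (simp add: span)
  have "\<forall>v\<in>D. \<exists>t. t \<in> S \<and> column t A = v" using D(1) by blast
  then obtain idx where idx: "\<And>v. v \<in> D \<Longrightarrow> idx v \<in> S \<and> column (idx v) A = v" by metis
  \<comment> \<open>\<open>idx\<close> picks one index for each vector, because equal columns may
    occur at several indices.\<close>
  define B where "B = idx ` D"
  have "inj_on idx D" by (rule inj_onI) (metis idx)
  then have cardB: "card B = CARD('m)" by (simp add: B_def card_image cardD)
  define e where "e = (basis_enum B :: 'm \<Rightarrow> 'n)"
  have finB: "finite B" using cardB by (metis card.infinite zero_less_card_finite less_irrefl)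
  have "\<exists>f. bij_betw f (UNIV :: 'm set) B" using cardB finB by (intro finite_same_card_bij) auto
  then have e: "bij_betw e UNIV B" unfolding e_def basis_enum_def by (rule someI_ex)
  let ?M = "basis_matrix A B"
  have col: "column i ?M = column (e i) A" for i
    by (simp add: column_def basis_matrix_def select_columns_def e_def)
  have "columns ?M = D"
  proof -
    have "columns ?M = (\<lambda>t. column t A) ` B"
      using bij_betw_imp_surj_on[OF e] by (auto simp: columns_def col)
    also have "\<dots> = D" unfolding B_def image_image using idx by (simp cong: image_cong)
    finally show ?thesis .
  qed
  then have "\<exists>N. ?M ** N = mat 1"
    using spanD matrix_right_invertible_span_columns[of ?M] by (simp add: span_vec_eq)
  then have inv: "invertible ?M" by (simp add: invertible_right_inverse)
  have "p v* ?M = select_entries c e"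
  proof -
    have "(p v* ?M) $ i = p \<bullet> column i ?M" for i
      by (simp add: vector_matrix_mult_def inner_vec_def column_def mult.commute)
    moreover have "e i \<in> S" for i
      using bij_betw_imp_surj_on[OF e] idx B_def by (metis imageE rangeI)
    ultimately show ?thesis by (simp add: vec_eq_iff col tight select_entries_def)
  qed
  then have "dual_basic_solution A c B = (p v* ?M) v* matrix_inv ?M"
    by (simp add: dual_basic_solution_def e_def)
  also have "\<dots> = p v* (?M ** matrix_inv ?M)" by (simp add: vector_matrix_mul_assoc)
  also have "?M ** matrix_inv ?M = mat 1"
    unfolding matrix_inv_def using someI_ex[OF inv[unfolded invertible_def]] by blast
  also have "p v* mat 1 = p" by simp
  finally show ?thesis using cardB inv by (auto simp: is_basis_def)
qed

section \<open>From a dual basis to the gap of the sampled problem\<close>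

lemma inner_vector_matrix_mult: "(p v* A) $ t = p \<bullet> column t A"
  for A :: "real^'n^'m"
  by (simp add: vector_matrix_mult_def inner_vec_def column_def mult.commute)

text \<open>The dual vertex \<open>p\<close> is feasible at the sampled columns only, so reduced
  costs are nonnegative there and may be negative elsewhere. Since \<open>A *v x = b\<close>,
  \<open>p \<bullet> b\<close> is \<open>c \<bullet> x\<close> minus the population mean of
  \<open>h\<close> times the reduced cost; adding the nonnegative sample mean turns this error into
  a deviation.\<close>

lemma sampled_lp_lower_value_bound:
  fixes A :: "real^'n^'m" and c \<xi> x :: "real^'n" and w :: "'k::finite \<Rightarrow> 'n"
  assumes feas: "std_feasible (select_columns A w) b \<noteq> {}"
    and rank: "rank (select_columns A w) = CARD('m)"
    and low: "\<And>y. y \<in> std_feasible (select_columns A w) b \<Longrightarrow> L < select_entries c w \<bullet> y"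
    and Ax: "A *v x = b" and h0: "\<And>t. 0 \<le> h t" and hx: "\<And>t. \<xi> $ t * h t = x $ t"
  shows "\<exists>B. is_basis A B \<and> L \<le> c \<bullet> x +
    ((1 / real CARD('k)) * (\<Sum>k\<in>UNIV. h (w k) * reduced_cost A c B $ w k) -
     (\<Sum>t\<in>UNIV. \<xi> $ t * (h t * reduced_cost A c B $ t)))"
proof -
  have col: "column k (select_columns A w) = column (w k) A" for k
    by (simp add: column_def select_columns_def)
  have ent: "select_entries c w $ k = c $ w k" for k by (simp add: select_entries_def)
  obtain p where pc: "\<And>k. p \<bullet> column (w k) A \<le> c $ w k" and pb: "L \<le> p \<bullet> b"
    and sp: "span {column (w k) A | k. p \<bullet> column (w k) A = c $ w k} = UNIV"
    using lp_dual_vertex_exists[OF feas low rank] unfolding col ent by blast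
  define S where "S = {t. p \<bullet> column t A = c $ t}"
  have "span {column (w k) A | k. p \<bullet> column (w k) A = c $ w k} \<subseteq> span {column t A | t. t \<in> S}"
    by (intro span_mono) (auto simp: S_def)
  then have spS: "span {column t A | t. t \<in> S} = UNIV" using sp by auto
  have "p \<bullet> column t A = c $ t" if "t \<in> S" for t using that by (simp add: S_def)
  from spanning_tight_columns_basis[OF spS this]
  obtain B where B: "is_basis A B" "dual_basic_solution A c B = p" by blast
  have rc: "reduced_cost A c B $ t = c $ t - p \<bullet> column t A" for t
    by (simp add: reduced_cost_def B(2) inner_vector_matrix_mult)
  have "p \<bullet> b = (\<Sum>t\<in>UNIV. x $ t * (p \<bullet> column t A))"
    unfolding Ax[symmetric] matrix_vector_mult_columns by (simp add: inner_sum_right)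
  also have "\<dots> = c \<bullet> x - (\<Sum>t\<in>UNIV. x $ t * reduced_cost A c B $ t)"
    by (simp add: inner_vec_def rc algebra_simps sum_subtractf)
  also have "(\<Sum>t\<in>UNIV. x $ t * reduced_cost A c B $ t) =
      (\<Sum>t\<in>UNIV. \<xi> $ t * (h t * reduced_cost A c B $ t))"
    by (simp flip: hx add: mult.assoc)
  finally have "p \<bullet> b = c \<bullet> x - \<dots>" .
  moreover have "0 \<le> (1 / real CARD('k)) * (\<Sum>k\<in>UNIV. h (w k) * reduced_cost A c B $ w k)"
    using pc h0 by (intro mult_nonneg_nonneg sum_nonneg) (auto simp: rc)
  ultimately show ?thesis using pb B(1) by (intro exI[of _ B]) simp
qed

lemma value_gap_sample_le:
  fixes A :: "real^'n^'m" and c \<xi> x :: "real^'n" and w :: "'k::finite \<Rightarrow> 'n"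
  assumes P: "std_feasible A b \<noteq> {}" "lp_bounded c (std_feasible A b)"
    and feas: "std_feasible (select_columns A w) b \<noteq> {}"
    and rank: "rank (select_columns A w) = CARD('m)"
    and x: "x \<in> S" "\<And>y. y \<in> S \<Longrightarrow> c \<bullet> x \<le> c \<bullet> y"
    and Ax: "A *v x = b" and h0: "\<And>t. 0 \<le> h t" and hx: "\<And>t. \<xi> $ t * h t = x $ t"
    and D: "\<And>B. is_basis A B \<Longrightarrow>
      (1 / real CARD('k)) * (\<Sum>k\<in>UNIV. h (w k) * reduced_cost A c B $ w k) -
      (\<Sum>t\<in>UNIV. \<xi> $ t * (h t * reduced_cost A c B $ t)) \<le> D"
  shows "value_gap A b c (opt_value (select_entries c w) (std_feasible (select_columns A w) b))
    \<le> value_gap A b c (opt_value c S) + ereal D"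
proof -
  let ?v = "opt_value (select_entries c w) (std_feasible (select_columns A w) b)"
  have "opt_value c S = ereal (c \<bullet> x)"
    unfolding opt_value_def using x by (intro antisym INF_lower INF_greatest) auto
  \<comment> \<open>A finite optimal value can be subtracted from both sides of an
    \<open>ereal\<close> inequality.\<close>
  moreover obtain v0 where v0: "opt_value c (std_feasible A b) = ereal v0"
  proof -
    obtain L where "\<forall>x\<in>std_feasible A b. L \<le> c \<bullet> x" using P(2) by (auto simp: lp_bounded_def)
    then have "ereal L \<le> opt_value c (std_feasible A b)"
      unfolding opt_value_def by (intro INF_greatest) auto
    moreover obtain y where "y \<in> std_feasible A b" using P(1) by blast
    then have "opt_value c (std_feasible A b) \<le> ereal (c \<bullet> y)"
      unfolding opt_value_def by (intro INF_lower)
    ultimately show ?thesis using that by (cases "opt_value c (std_feasible A b)") auto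
  qed
  moreover have "?v \<le> ereal (c \<bullet> x + D)"
  \<comment> \<open>Working with a real \<open>L\<close> strictly between the two sides spares a
    proof that the sampled optimum is finite and attained.\<close>
  proof (rule ccontr)
    assume "\<not> ?v \<le> ereal (c \<bullet> x + D)"
    then obtain L where L: "ereal (c \<bullet> x + D) < ereal L" "ereal L < ?v"
      using ereal_dense2 by (meson not_le)
    have "L < select_entries c w \<bullet> y" if "y \<in> std_feasible (select_columns A w) b" for y
    proof -
      have "?v \<le> ereal (select_entries c w \<bullet> y)" unfolding opt_value_def by (rule INF_lower[OF that])
      then show ?thesis using L(2) by (metis less_ereal.simps(1) order_less_le_trans)
    qed
    from sampled_lp_lower_value_bound[OF feas rank this Ax h0 hx] D have "L \<le> c \<bullet> x + D"
      by (meson add_left_mono order_trans)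
    then show False using L(1) by simp
  qed
  then have "?v - ereal v0 \<le> ereal (c \<bullet> x + D) - ereal v0" by (intro ereal_minus_mono) auto
  ultimately show ?thesis by (simp add: value_gap_def algebra_simps)
qed

section \<open>The sampled linear program\<close>

lemma abs_le_max_norm: "\<bar>A $ i $ j\<bar> \<le> max_norm A" for A :: "real^'n^'m"
proof -
  have "{\<bar>A $ i $ j\<bar> | i j. True} = (\<lambda>(i, j). \<bar>A $ i $ j\<bar>) ` UNIV" by auto
  then have "finite {\<bar>A $ i $ j\<bar> | i j. True}" by simp
  then show ?thesis unfolding max_norm_def by (intro Max_ge) auto
qed

lemma norm_column_le: "(norm (column t A))\<^sup>2 \<le> real CARD('m) * (max_norm A)\<^sup>2" for A :: "real^'n^'m"
proof -
  have "(norm (column t A))\<^sup>2 = (\<Sum>i\<in>UNIV. (A $ i $ t)\<^sup>2)"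
    by (simp only: power2_norm_eq_inner) (simp add: inner_vec_def column_def power2_eq_square)
  also have "\<dots> \<le> (\<Sum>i\<in>(UNIV :: 'm set). (max_norm A)\<^sup>2)"
    using power_mono[OF abs_le_max_norm abs_ge_zero, of A _ t 2] by (intro sum_mono) simp
  finally show ?thesis by simp
qed

lemma span_columns_full_rank:
  fixes A :: "real^'n^'m"
  assumes "rank A = CARD('m)"
  shows "span {column t A | t. t \<in> UNIV} = UNIV"
proof -
  have "v \<in> span {column t A | t. t \<in> UNIV}" for v
  proof -
    obtain y where "v = A *v y" using assms full_rank_surjective by (metis surjD)
    moreover have "A *v y \<in> span {column t A | t. t \<in> UNIV}"
      unfolding matrix_vector_mult_columns by (intro span_sum span_scale span_base) auto
    ultimately show ?thesis by simp
  qed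
  then show ?thesis by auto
qed

text \<open>For \<open>c = 0\<close> and \<open>p = 0\<close> every column is tight, and
  \<open>is_basis\<close> does not involve \<open>c\<close>. The existence of a basis gives the
  bounds \<open>\<gamma>\<close> and \<open>chi\<close> their sign.\<close>

lemma full_rank_is_basis:
  fixes A :: "real^'n^'m"
  assumes "rank A = CARD('m)"
  obtains B where "is_basis A B"
  using spanning_tight_columns_basis[OF span_columns_full_rank[OF assms], of 0 0] by auto

lemma box_optimum_exists:
  fixes A :: "real^'n^'m"
  assumes "box_feasible A b u \<noteq> {}"
  obtains x where "x \<in> box_feasible A b u" "\<And>y. y \<in> box_feasible A b u \<Longrightarrow> c \<bullet> x \<le> c \<bullet> y"
proof -
  have "box_feasible A b u = {x. A *v x = b} \<inter> cbox 0 u"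
    by (auto simp: box_feasible_def mem_box_cart)
  moreover have "closed {x. A *v x = b}"
    by (intro closed_Collect_eq continuous_intros matrix_vector_mult_linear_continuous_on)
  ultimately have "compact (box_feasible A b u)" by (simp add: closed_Int_compact)
  moreover have "continuous_on (box_feasible A b u) (\<lambda>x. c \<bullet> x)" by (intro continuous_intros)
  ultimately obtain x where "x \<in> box_feasible A b u" "\<forall>y\<in>box_feasible A b u. c \<bullet> x \<le> c \<bullet> y"
    using continuous_attains_inf[OF _ assms] by blast
  then show ?thesis using that by blast
qed

text \<open>The reduced cost of column \<open>t\<close> is the inner product of \<open>(1, -p/s)\<close> with \<open>(c\<^sub>t, s A\<^sub>t)\<close>;
  the scale \<open>s\<^sup>2 = \<gamma> / \<parallel>A\<parallel>\<^sub>m\<^sub>a\<^sub>x\<close> balances the norms of the two factors.\<close>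

lemma reduced_cost_factorization:
  fixes A :: "real^'n^'m" and c :: "real^'n"
  assumes rank_A: "rank A = CARD('m)" and norm_c: "norm c = 1"
    and \<gamma>: "\<forall>B. is_basis A B \<longrightarrow> infnorm (dual_basic_solution A c B) \<le> \<gamma>"
  shows "\<exists>(g :: 'n \<Rightarrow> real \<times> (real^'m)) r l. (\<forall>t. norm (g t) \<le> r) \<and>
    (\<forall>B. is_basis A B \<longrightarrow> norm (l B) \<le> r \<and> (\<forall>t. l B \<bullet> g t = reduced_cost A c B $ t)) \<and>
    0 \<le> r \<and> r * r = 1 + real CARD('m) * \<gamma> * max_norm A"
proof -
  define a where "a = max_norm A"
  define m where "m = real CARD('m)"
  define s where "s = sqrt (\<gamma> / a)"
  define r where "r = sqrt (1 + m * \<gamma> * a)"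
  define g where "g t = (c $ t, s *\<^sub>R column t A)" for t
  define l where "l B = (1 :: real, - (1 / s) *\<^sub>R dual_basic_solution A c B)" for B
  obtain B0 where "is_basis A B0" by (rule full_rank_is_basis[OF rank_A])
  then have \<gamma>0: "0 \<le> \<gamma>" using \<gamma> infnorm_pos_le order_trans by blast
  have "a \<noteq> 0"
  proof
    assume "a = 0"
    then have "A = 0" using abs_le_max_norm[of A] by (simp add: a_def vec_eq_iff)
    then show False using rank_A by simp
  qed
  moreover have "0 \<le> a" unfolding a_def using abs_le_max_norm[of A undefined undefined] by linarith
  ultimately have a: "0 < a" by simp
  have m: "0 \<le> m" by (simp add: m_def)
  have s2: "s\<^sup>2 = \<gamma> / a" using \<gamma>0 a by (simp add: s_def)
  have r0: "0 \<le> 1 + m * \<gamma> * a" using m \<gamma>0 a by simp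
  have g: "norm (g t) \<le> r" for t
  proof -
    have "(norm (g t))\<^sup>2 = (c $ t)\<^sup>2 + s\<^sup>2 * (norm (column t A))\<^sup>2"
      by (simp add: g_def norm_prod_def power_mult_distrib)
    also have "\<dots> \<le> 1 + s\<^sup>2 * (m * a\<^sup>2)"
    proof (intro add_mono mult_left_mono)
      show "(c $ t)\<^sup>2 \<le> 1" using component_le_norm_cart[of c t] norm_c
        by (simp add: abs_square_le_1)
      show "(norm (column t A))\<^sup>2 \<le> m * a\<^sup>2" unfolding m_def a_def by (rule norm_column_le)
    qed simp
    also have "\<dots> = 1 + m * \<gamma> * a" unfolding s2 using a by (simp add: power2_eq_square)
    finally show ?thesis unfolding r_def by (rule real_le_rsqrt)
  qed
  have l: "norm (l B) \<le> r" "l B \<bullet> g t = reduced_cost A c B $ t" if B: "is_basis A B" for B t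
  proof -
    define p where "p = dual_basic_solution A c B"
    have ip: "infnorm p \<le> \<gamma>" using \<gamma> B by (simp add: p_def)
    have "norm p \<le> sqrt (real DIM(real^'m)) * infnorm p" by (rule norm_le_infnorm)
    also have "\<dots> \<le> sqrt m * \<gamma>" using ip by (simp add: m_def mult_left_mono)
    finally have "(norm p)\<^sup>2 \<le> (sqrt m * \<gamma>)\<^sup>2" by (intro power_mono) auto
    then have np: "(norm p)\<^sup>2 \<le> m * \<gamma>\<^sup>2" using m by (simp add: power_mult_distrib)
    have "(norm (l B))\<^sup>2 = 1 + (norm p)\<^sup>2 / s\<^sup>2"
      by (simp add: l_def norm_prod_def power_mult_distrib power_divide p_def)
    also have "\<dots> \<le> 1 + m * \<gamma>\<^sup>2 / s\<^sup>2" using np by (intro add_left_mono divide_right_mono) auto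
    also have "\<dots> = 1 + m * \<gamma> * a" unfolding s2 using a by (cases "\<gamma> = 0") (simp_all add: power2_eq_square)
    finally show "norm (l B) \<le> r" unfolding r_def by (rule real_le_rsqrt)
    \<comment> \<open>For \<open>\<gamma> = 0\<close> the scale vanishes and \<open>1 / s\<close> is
      0 by convention, so the two scales no longer cancel; the identity survives because
      \<open>p\<close> vanishes too.\<close>
    have "p = 0" if "s = 0"
    proof -
      have "\<gamma> = 0" using that s2 a by simp
      then show ?thesis using np by simp
    qed
    then have "l B \<bullet> g t = c $ t - p \<bullet> column t A"
      by (cases "s = 0") (simp_all add: l_def g_def p_def[symmetric])
    then show "l B \<bullet> g t = reduced_cost A c B $ t"
      by (simp add: reduced_cost_def p_def inner_vector_matrix_mult)
  qed
  have "r * r = 1 + real CARD('m) * \<gamma> * max_norm A"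
    using r0 by (simp add: r_def m_def a_def)
  moreover have "0 \<le> r" using r0 by (simp add: r_def)
  ultimately show ?thesis using g l by (intro exI[of _ g] exI[of _ r] exI[of _ l]) simp
qed

text \<open>Common core of both claims. The vector \<open>g t y\<close> pairs with
  \<open>l B\<close> to \<open>y\<close> times the reduced cost of column \<open>t\<close>; the
  scalar is a separate argument because \<open>h\<close> is constructed only inside the proof, from
  an optimum of the box problem.\<close>

lemma sampled_value_gap_probability:
  fixes A :: "real^'n^'m" and b :: "real^'m" and c \<xi> :: "real^'n" and C :: real
    and M :: "'w measure" and J :: "'k::finite \<Rightarrow> 'w \<Rightarrow> 'n" and G :: "'k ugraph"
    and g :: "'n \<Rightarrow> real \<Rightarrow> 'v::real_inner" and l :: "'n set \<Rightarrow> 'v"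
  assumes P: "std_feasible A b \<noteq> {}" "lp_bounded c (std_feasible A b)"
    and C: "0 \<le> C" and \<xi>0: "\<forall>t. 0 \<le> \<xi> $ t" and M: "prob_space M"
    and J: "\<forall>k. J k \<in> measurable M (count_space UNIV)"
    and marg: "\<forall>k t. measure M {\<omega> \<in> space M. J k \<omega> = t} = \<xi> $ t"
    and dep: "dependency_graph M (count_space UNIV) J G"
    and g: "\<And>t y. \<bar>y\<bar> \<le> C \<Longrightarrow> norm (g t y) \<le> R"
    and l: "\<And>B. is_basis A B \<Longrightarrow> norm (l B) \<le> r"
    and lg: "\<And>B t y. is_basis A B \<Longrightarrow> l B \<bullet> g t y = y * reduced_cost A c B $ t"
    and r: "0 \<le> r" and \<delta>: "0 < \<delta>" "\<delta> < 1"
    and bd: "r * (R * (sqrt ((real CARD('k) + 2 * real (card (edges G))) / (real CARD('k))\<^sup>2) +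
       sqrt (2 * real (forest_complexity G) * ln (1 / \<delta>) / (real CARD('k))\<^sup>2))) \<le> D"
  shows "1 - \<delta> \<le> measure M {\<omega> \<in> space M.
     (let A\<^sub>J = select_columns A (\<lambda>k. J k \<omega>); c\<^sub>J = select_entries c (\<lambda>k. J k \<omega>) in
      std_feasible A\<^sub>J b \<noteq> {} \<and> rank A\<^sub>J = CARD('m) \<longrightarrow>
      value_gap A b c (opt_value c\<^sub>J (std_feasible A\<^sub>J b))
        \<le> value_gap A b c (opt_value c (box_feasible A b (C *\<^sub>R \<xi>))) + ereal D)}"
proof -
  define S where "S = box_feasible A b (C *\<^sub>R \<xi>)"
  define q where "q = law M J"
  define Q where "Q w \<longleftrightarrow> (std_feasible (select_columns A w) b \<noteq> {} \<and>
      rank (select_columns A w) = CARD('m) \<longrightarrow>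
      value_gap A b c (opt_value (select_entries c w) (std_feasible (select_columns A w) b))
        \<le> value_gap A b c (opt_value c S) + ereal D)" for w :: "'k \<Rightarrow> 'n"
  have Jm: "\<And>k. J k \<in> measurable M (count_space UNIV)" using J by blast
  have q: "prob_weight q" unfolding q_def by (rule prob_weight_law[OF M Jm])
  have "1 - \<delta> \<le> sum q {w. Q w}"
  \<comment> \<open>If the box problem is infeasible, its gap is infinite and the event is
    certain.\<close>
  proof (cases "S = {}")
    case True
    have "opt_value c (std_feasible A b) \<noteq> \<infinity>"
    proof -
      obtain y where "y \<in> std_feasible A b" using P(1) by blast
      then have "opt_value c (std_feasible A b) \<le> ereal (c \<bullet> y)"
        unfolding opt_value_def by (rule INF_lower)
      then show ?thesis by auto
    qed
    then have "value_gap A b c (opt_value c S) = \<infinity>"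
      by (simp add: value_gap_def opt_value_def True top_ereal_def)
    then have "{w. Q w} = UNIV" by (simp add: Q_def)
    then show ?thesis using q \<delta> by (simp add: prob_weight_def)
  next
    case False
    obtain x where x: "x \<in> S" "\<And>y. y \<in> S \<Longrightarrow> c \<bullet> x \<le> c \<bullet> y"
      using box_optimum_exists[of A b "C *\<^sub>R \<xi>" c] False unfolding S_def by metis
    have Ax: "A *v x = b" and x0: "\<And>t. 0 \<le> x $ t" and xC: "\<And>t. x $ t \<le> C * \<xi> $ t"
      using x(1) by (auto simp: S_def box_feasible_def)
    define h where "h t = x $ t / \<xi> $ t" for t
    have h0: "0 \<le> h t" for t using x0 \<xi>0 by (simp add: h_def)
    \<comment> \<open>Where \<open>\<xi> $ t\<close> is zero, \<open>h t\<close> is zero by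
      convention, and the box forces \<open>x $ t\<close> to be zero as well.\<close>
    have hx: "\<xi> $ t * h t = x $ t" for t
      using x0[of t] xC[of t] by (cases "\<xi> $ t = 0") (auto simp: h_def)
    have hC: "\<bar>h t\<bar> \<le> C" for t
    proof (cases "\<xi> $ t = 0")
      case False
      then have "0 < \<xi> $ t" using \<xi>0 by (simp add: less_le)
      then have "h t \<le> C" using xC[of t] by (simp add: h_def pos_divide_le_eq)
      then show ?thesis using h0[of t] by simp
    qed (simp add: h_def C)
    define dev where "dev w = (1 / real CARD('k)) *\<^sub>R (\<Sum>k\<in>UNIV. g (w k) (h (w k))) -
      (\<Sum>t\<in>UNIV. \<xi> $ t *\<^sub>R g t (h t))" for w :: "'k \<Rightarrow> 'n"
    define \<beta> where "\<beta> = R * (sqrt ((real CARD('k) + 2 * real (card (edges G))) / (real CARD('k))\<^sup>2) +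
       sqrt (2 * real (forest_complexity G) * ln (1 / \<delta>) / (real CARD('k))\<^sup>2))"
    have "Q w" if w: "norm (dev w) \<le> \<beta>" for w
      unfolding Q_def
    proof (intro impI, elim conjE)
      assume "std_feasible (select_columns A w) b \<noteq> {}" "rank (select_columns A w) = CARD('m)"
      then show "value_gap A b c (opt_value (select_entries c w) (std_feasible (select_columns A w) b))
          \<le> value_gap A b c (opt_value c S) + ereal D"
      proof (rule value_gap_sample_le[OF P _ _ x Ax h0 hx])
        fix B assume B: "is_basis A B"
        have "(1 / real CARD('k)) * (\<Sum>k\<in>UNIV. h (w k) * reduced_cost A c B $ w k) -
            (\<Sum>t\<in>UNIV. \<xi> $ t * (h t * reduced_cost A c B $ t)) = l B \<bullet> dev w"
          by (simp add: dev_def inner_diff_right inner_sum_right lg[OF B])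
        also have "\<dots> \<le> norm (l B) * norm (dev w)" by (rule norm_cauchy_schwarz)
        also have "\<dots> \<le> r * \<beta>" using l[OF B] w r by (intro mult_mono) auto
        also have "\<dots> \<le> D" using bd by (simp add: \<beta>_def)
        finally show "(1 / real CARD('k)) * (\<Sum>k\<in>UNIV. h (w k) * reduced_cost A c B $ w k) -
            (\<Sum>t\<in>UNIV. \<xi> $ t * (h t * reduced_cost A c B $ t)) \<le> D" .
      qed
    qed
    then have sub: "{w. norm (dev w) \<le> \<beta>} \<subseteq> {w. Q w}" by blast
    have "1 - \<delta> \<le> sum q {w. norm (dev w) \<le> \<beta>}"
      unfolding dev_def \<beta>_def
    proof (rule sample_mean_concentration[OF q])
      show "dependency_weights q G" unfolding q_def by (rule dependency_weights_law[OF M Jm dep])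
      show "wexp q (\<lambda>w. if w k = t then 1 else 0) = \<xi> $ t" for k t
        unfolding q_def using marginal_law[OF M Jm] marg by simp
    qed (use dep g hC \<delta> in \<open>auto simp: dependency_graph_def\<close>)
    also have "\<dots> \<le> sum q {w. Q w}" using q sub by (intro sum_mono2) (auto simp: prob_weight_def)
    finally show ?thesis .
  qed
  also have "\<dots> = measure M {\<omega> \<in> space M. Q (\<lambda>k. J k \<omega>)}"
    unfolding q_def by (rule measure_outcome[OF M Jm, symmetric])
  finally show ?thesis by (simp add: Q_def S_def Let_def)
qed

theorem mainTheorem12:
  fixes A :: "real^'n^'m" and b :: "real^'m" and c :: "real^'n"
    and \<xi> :: "real^'n" and C \<gamma> chi :: real
    and M :: "'w measure" and J :: "'k::finite \<Rightarrow> 'w \<Rightarrow> 'n" and G :: "'k ugraph"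
  assumes P_feasible: "std_feasible A b \<noteq> {}"
    and P_bounded: "lp_bounded c (std_feasible A b)"
    and rank_A: "rank A = CARD('m)"
    and norm_c: "norm c = 1"
    and C_nonneg: "0 \<le> C"
    and \<xi>_nonneg: "\<forall>t. 0 \<le> \<xi> $ t"
    and \<xi>_sum: "(\<Sum>t\<in>UNIV. \<xi> $ t) = 1"
    and M: "prob_space M"
    and J_rv: "\<forall>k. J k \<in> measurable M (count_space UNIV)"
    and J_marginal: "\<forall>k t. measure M {\<omega> \<in> space M. J k \<omega> = t} = \<xi> $ t"
    and J_dep: "dependency_graph M (count_space UNIV) J G"
    and gamma_bound: "\<forall>B. is_basis A B \<longrightarrow> infnorm (dual_basic_solution A c B) \<le> \<gamma>"
    and chi_bound: "\<forall>B. is_basis A B \<longrightarrow> norm (reduced_cost A c B) \<le> chi"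
  shows
    "(\<forall>\<delta>::real. 0 < \<delta> \<and> \<delta> < 1 \<longrightarrow>
       1 - \<delta> \<le> measure M {\<omega> \<in> space M.
         (let A\<^sub>J = select_columns A (\<lambda>k. J k \<omega>); c\<^sub>J = select_entries c (\<lambda>k. J k \<omega>) in
          std_feasible A\<^sub>J b \<noteq> {} \<and> rank A\<^sub>J = CARD('m) \<longrightarrow>
          value_gap A b c (opt_value c\<^sub>J (std_feasible A\<^sub>J b))
            \<le> value_gap A b c (opt_value c (box_feasible A b (C *\<^sub>R \<xi>)))
              + ereal (C * (1 + real CARD('m) * \<gamma> * max_norm A) *
                  (sqrt ((real CARD('k) + 2 * real (card (edges G))) / (real CARD('k))\<^sup>2) +
                   sqrt (2 * real (forest_complexity G) * ln (2 / \<delta>) / (real CARD('k))\<^sup>2))))})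
     \<and>
     (\<forall>\<delta>::real. 0 < \<delta> \<and> \<delta> < 1 \<longrightarrow>
       1 - \<delta> \<le> measure M {\<omega> \<in> space M.
         (let A\<^sub>J = select_columns A (\<lambda>k. J k \<omega>); c\<^sub>J = select_entries c (\<lambda>k. J k \<omega>) in
          std_feasible A\<^sub>J b \<noteq> {} \<and> rank A\<^sub>J = CARD('m) \<longrightarrow>
          value_gap A b c (opt_value c\<^sub>J (std_feasible A\<^sub>J b))
            \<le> value_gap A b c (opt_value c (box_feasible A b (C *\<^sub>R \<xi>)))
              + ereal (C * chi *
                  (sqrt ((real CARD('k) + 2 * real (card (edges G))) / (real CARD('k))\<^sup>2) +
                   sqrt (2 * real (forest_complexity G) * ln (1 / \<delta>) / (real CARD('k))\<^sup>2))))})"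
proof (intro conjI allI impI; elim conjE)
  fix \<delta> :: real assume \<delta>: "0 < \<delta>" "\<delta> < 1"
  obtain g :: "'n \<Rightarrow> real \<times> (real^'m)" and r l where
    gl: "\<forall>t. norm (g t) \<le> r"
      "\<forall>B. is_basis A B \<longrightarrow> norm (l B) \<le> r \<and> (\<forall>t. l B \<bullet> g t = reduced_cost A c B $ t)"
    and r: "0 \<le> r" and rr: "r * r = 1 + real CARD('m) * \<gamma> * max_norm A"
    using reduced_cost_factorization[OF rank_A norm_c gamma_bound] by blast
  note g = gl(1)[rule_format] and l = gl(2)[rule_format, THEN conjunct1]
    and lg = gl(2)[rule_format, THEN conjunct2, rule_format]
  let ?\<alpha> = "sqrt ((real CARD('k) + 2 * real (card (edges G))) / (real CARD('k))\<^sup>2)"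
  let ?\<eta> = "\<lambda>u. sqrt (2 * real (forest_complexity G) * ln (u / \<delta>) / (real CARD('k))\<^sup>2)"
  show "1 - \<delta> \<le> measure M {\<omega> \<in> space M.
         (let A\<^sub>J = select_columns A (\<lambda>k. J k \<omega>); c\<^sub>J = select_entries c (\<lambda>k. J k \<omega>) in
          std_feasible A\<^sub>J b \<noteq> {} \<and> rank A\<^sub>J = CARD('m) \<longrightarrow>
          value_gap A b c (opt_value c\<^sub>J (std_feasible A\<^sub>J b))
            \<le> value_gap A b c (opt_value c (box_feasible A b (C *\<^sub>R \<xi>)))
              + ereal (C * (1 + real CARD('m) * \<gamma> * max_norm A) *
                  (sqrt ((real CARD('k) + 2 * real (card (edges G))) / (real CARD('k))\<^sup>2) +
                   sqrt (2 * real (forest_complexity G) * ln (2 / \<delta>) / (real CARD('k))\<^sup>2))))}"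
  proof (rule sampled_value_gap_probability[OF P_feasible P_bounded C_nonneg \<xi>_nonneg M J_rv
        J_marginal J_dep, where g = "\<lambda>t y. y *\<^sub>R g t" and R = "C * r" and l = l and r = r])
    show "norm (y *\<^sub>R g t) \<le> C * r" if "\<bar>y\<bar> \<le> C" for t y
      using that g[of t] C_nonneg by (simp add: mult_mono)
    show "l B \<bullet> (y *\<^sub>R g t) = y * reduced_cost A c B $ t" if "is_basis A B" for B t y
      by (simp add: lg[OF that])
    \<comment> \<open>The core lemma yields the logarithm of 1/\<delta>, and the stated bound with
      2/\<delta> is larger.\<close>
    have "ln (1 / \<delta>) \<le> ln (2 / \<delta>)" using \<delta> by (simp add: ln_div)
    then have "?\<eta> 1 \<le> ?\<eta> 2" by (intro real_sqrt_le_mono divide_right_mono mult_left_mono) auto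
    then have "C * (r * r) * (?\<alpha> + ?\<eta> 1) \<le> C * (r * r) * (?\<alpha> + ?\<eta> 2)"
      using C_nonneg r by (intro mult_left_mono add_left_mono) auto
    then show "r * (C * r * (?\<alpha> + ?\<eta> 1)) \<le> C * (1 + real CARD('m) * \<gamma> * max_norm A) * (?\<alpha> + ?\<eta> 2)"
      unfolding rr[symmetric] by (simp only: mult_ac)
  qed (use l r \<delta> in auto)
next
  fix \<delta> :: real assume \<delta>: "0 < \<delta>" "\<delta> < 1"
  obtain B0 where "is_basis A B0" by (rule full_rank_is_basis[OF rank_A])
  then have chi: "0 \<le> chi" using chi_bound norm_ge_zero order_trans by blast
  show "1 - \<delta> \<le> measure M {\<omega> \<in> space M.
         (let A\<^sub>J = select_columns A (\<lambda>k. J k \<omega>); c\<^sub>J = select_entries c (\<lambda>k. J k \<omega>) in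
          std_feasible A\<^sub>J b \<noteq> {} \<and> rank A\<^sub>J = CARD('m) \<longrightarrow>
          value_gap A b c (opt_value c\<^sub>J (std_feasible A\<^sub>J b))
            \<le> value_gap A b c (opt_value c (box_feasible A b (C *\<^sub>R \<xi>)))
              + ereal (C * chi *
                  (sqrt ((real CARD('k) + 2 * real (card (edges G))) / (real CARD('k))\<^sup>2) +
                   sqrt (2 * real (forest_complexity G) * ln (1 / \<delta>) / (real CARD('k))\<^sup>2))))}"
  \<comment> \<open>Here the reduced cost vector itself is the factor depending on the basis, and
    column \<open>t\<close> is represented by a multiple of a unit vector; the norms are at most
    \<open>chi\<close> and \<open>C\<close>.\<close>
  proof (rule sampled_value_gap_probability[OF P_feasible P_bounded C_nonneg \<xi>_nonneg M J_rv
        J_marginal J_dep, where g = axis and R = C and l = "reduced_cost A c" and r = chi])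
    show "norm (axis t y) \<le> C" if "\<bar>y\<bar> \<le> C" for t :: 'n and y :: real
      using that by (simp add: norm_eq_sqrt_inner inner_axis_axis)
    show "reduced_cost A c B \<bullet> axis t y = y * reduced_cost A c B $ t" for B t y
      by (simp add: inner_axis)
  qed (use chi_bound chi \<delta> in auto)
qed

end
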